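(* Let $\mathcal{K}$ be the class of $9/8$-closed groups, and let $\mathcal{L}=\{K\wr S_n:K\in\mathcal{K}\text{ and }n\ge 2\text{ is an integer}\}$. Then the class of $3/2$-closed groups is the disjoint union of $\mathcal{K}$ and $\mathcal{L}$.
   Context: Permutation groups are considered up to permutation isomorphism; degrees are finite, and a group of degree $n$ is viewed as acting on $\mathbb{Z}_n$. For $G\le S_X$ and $H\le S_Y$, $G\wr H$ is the group of all permutations of $X\times Y$ of the form $(x,y)\mapsto(g(x),h_x(y))$ with $g\in G$ and each $h_x\in H$. Let $G\le S_n$ be transitive. A block of $G$ is a nonempty set $B\subseteq\mathbb{Z}_n$ with $g(B)\cap B\in\{\emptyset,B\}$ for all $g\in G$; the partition $\{g(B):g\in G\}$ is a block system of $G$. A block system is normal if it is the set of orbits of a normal subgroup of $G$. $\mathrm{fix}_G(\mathcal{B})=\{g\in G:g(B)=B\text{ for all }B\in\mathcal{B}\}$. If a group $L$ preserves a set $B$, $L^B$ is the permutation group it induces on $B$. For a normal block system $\mathcal{B}$ of $G$ and $B\in\mathcal{B}$, $\mathrm{WStab}_G(B)$ is the largest subgroup $W\le\mathrm{fix}_G(\mathcal{B})$ such that $W^B=1$ and, for every other $B'\in\mathcal{B}$, $W^{B'}$ is either transitive on $B'$ or trivial (such a largest subgroup exists). Define $B\equiv B'$ iff $\mathrm{WStab}_G(B)=\mathrm{WStab}_G(B')$. The unions of the equivalence classes of $\equiv$ form a block system $\mathcal{E}_{G,\mathcal{B}}$ of $G$, the $\mathcal{B}$-fixer block system of $G$. If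 $g(X)=X$, $g|_X$ is the permutation equal to $g$ on $X$ and the identity off $X$. A transitive group $G\le S_n$ is $5/2$-closed if for every transitive $H\le G$, every normal block system $\mathcal{B}$ of $H$, every $E\in\mathcal{E}_{H,\mathcal{B}}$, and every $g\in G$ fixing setwise each block of $\mathcal{B}$ contained in $E$, one has $g|_E\in G$. A transitive $5/2$-closed group $G\le S_n$ is $9/8$-closed if $\mathcal{E}_{H,\mathcal{B}}=\{\mathbb{Z}_n\}$ for every transitive $H\le G$ and every normal block system $\mathcal{B}$ of $H$. A transitive $5/2$-closed group $G\le S_n$ is $3/2$-closed if for every transitive $H\le G$ and every normal block system $\mathcal{B}$ of $H$, letting $K_H$ be the largest subgroup of $G$ having $\mathcal{B}$ as a block system (then $\mathcal{B}$ is normal for $K_H$): (i) $\mathcal{E}_{K_H,\mathcal{B}}$ is either $\mathcal{B}$ or $\{\mathbb{Z}_n\}$; and (ii) whenever $\mathcal{E}_{H,\mathcal{B}}=\mathcal{B}\ne\{\mathbb{Z}_n\}$, $\mathrm{fix}_{K_H}(\mathcal{B})^B=S_B$ (the full symmetric group on $B$) for every $B\in\mathcal{B}$.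
   Formalization: The union is not literally disjoint: the trivial group of degree 1 is 9/8-closed, so for p prime S_p = 1 wr S_p lies in both K and L. The formal theorem proves that the class of 3/2-closed groups is K ∪ L and that K ∩ L is exactly {S_p : p prime}. *)

theory Defs
  imports
    "HOL-Algebra.Group_Action"
    "HOL-Algebra.Coset"
    "HOL-Combinatorics.Permutations"
    "HOL-Computational_Algebra.Primes"
begin

text \<open>
  A permutation group on \<open>X\<close> is represented by its set of elements, each a function fixing every
  point outside \<open>X\<close> (as in \<^const>\<open>permutes\<close>).
\<close>

definition sym_on :: "'a set \<Rightarrow> ('a \<Rightarrow> 'a) monoid" where
  "sym_on X = \<lparr>carrier = {p. p permutes X}, monoid.mult = (\<circ>), one = id\<rparr>"

abbreviation group_on :: "'a set \<Rightarrow> ('a \<Rightarrow> 'a) set \<Rightarrow> ('a \<Rightarrow> 'a) monoid" where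
  "group_on X G \<equiv> (sym_on X)\<lparr>carrier := G\<rparr>"

definition transitive_on :: "'a set \<Rightarrow> ('a \<Rightarrow> 'a) set \<Rightarrow> bool" where
  "transitive_on X G \<longleftrightarrow> (\<forall>x\<in>X. \<forall>y\<in>X. \<exists>g\<in>G. g x = y)"

definition transitive_group :: "'a set \<Rightarrow> ('a \<Rightarrow> 'a) set \<Rightarrow> bool" where
  "transitive_group X G \<longleftrightarrow>
     finite X \<and> X \<noteq> {} \<and> subgroup G (sym_on X) \<and> transitive_on X G"

definition is_block :: "'a set \<Rightarrow> ('a \<Rightarrow> 'a) set \<Rightarrow> 'a set \<Rightarrow> bool" where
  "is_block X G B \<longleftrightarrow> B \<noteq> {} \<and> B \<subseteq> X \<and> (\<forall>g\<in>G. g ` B \<inter> B \<in> {{}, B})"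

definition block_system :: "'a set \<Rightarrow> ('a \<Rightarrow> 'a) set \<Rightarrow> 'a set set \<Rightarrow> bool" where
  "block_system X G \<B> \<longleftrightarrow> (\<exists>B. is_block X G B \<and> \<B> = {g ` B | g. g \<in> G})"

definition normal_block_system :: "'a set \<Rightarrow> ('a \<Rightarrow> 'a) set \<Rightarrow> 'a set set \<Rightarrow> bool" where
  "normal_block_system X G \<B> \<longleftrightarrow>
     block_system X G \<B> \<and> (\<exists>N. N \<lhd> group_on X G \<and> \<B> = orbits (group_on X N) X (\<lambda>g. g))"

definition fix_group :: "('a \<Rightarrow> 'a) set \<Rightarrow> 'a set set \<Rightarrow> ('a \<Rightarrow> 'a) set" where
  "fix_group G \<B> = {g \<in> G. \<forall>B\<in>\<B>. g ` B = B}"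

definition induced :: "('a \<Rightarrow> 'a) set \<Rightarrow> 'a set \<Rightarrow> ('a \<Rightarrow> 'a) set" where
  "induced L B = {restrict_id g B | g. g \<in> L}"

definition wstab_cond ::
    "'a set \<Rightarrow> ('a \<Rightarrow> 'a) set \<Rightarrow> 'a set set \<Rightarrow> 'a set \<Rightarrow> ('a \<Rightarrow> 'a) set \<Rightarrow> bool" where
  "wstab_cond X G \<B> B W \<longleftrightarrow>
     subgroup W (group_on X (fix_group G \<B>)) \<and>
     induced W B = {id} \<and>
     (\<forall>B'\<in>\<B> - {B}. transitive_on B' (induced W B') \<or> induced W B' = {id})"

text \<open>\<open>GREATEST\<close> on sets is with respect to inclusion.\<close>

definition wstab :: "'a set \<Rightarrow> ('a \<Rightarrow> 'a) set \<Rightarrow> 'a set set \<Rightarrow> 'a set \<Rightarrow> ('a \<Rightarrow> 'a) set" where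
  "wstab X G \<B> B = (GREATEST W. wstab_cond X G \<B> B W)"

definition fixer_block_system :: "'a set \<Rightarrow> ('a \<Rightarrow> 'a) set \<Rightarrow> 'a set set \<Rightarrow> 'a set set" where
  "fixer_block_system X G \<B> =
     Union ` (\<B> // {(B, B'). B \<in> \<B> \<and> B' \<in> \<B> \<and> wstab X G \<B> B = wstab X G \<B> B'})"

definition five_half_closed :: "'a set \<Rightarrow> ('a \<Rightarrow> 'a) set \<Rightarrow> bool" where
  "five_half_closed X G \<longleftrightarrow>
     transitive_group X G \<and>
     (\<forall>H \<B> E g. transitive_group X H \<and> H \<subseteq> G \<and> normal_block_system X H \<B> \<and>
        E \<in> fixer_block_system X H \<B> \<and> g \<in> G \<and> (\<forall>B\<in>\<B>. B \<subseteq> E \<longrightarrow> g ` B = B) \<longrightarrow>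
        restrict_id g E \<in> G)"

definition nine_eighth_closed :: "'a set \<Rightarrow> ('a \<Rightarrow> 'a) set \<Rightarrow> bool" where
  "nine_eighth_closed X G \<longleftrightarrow>
     five_half_closed X G \<and>
     (\<forall>H \<B>. transitive_group X H \<and> H \<subseteq> G \<and> normal_block_system X H \<B> \<longrightarrow>
        fixer_block_system X H \<B> = {X})"

definition largest_with_blocks ::
    "'a set \<Rightarrow> ('a \<Rightarrow> 'a) set \<Rightarrow> 'a set set \<Rightarrow> ('a \<Rightarrow> 'a) set" where
  "largest_with_blocks X G \<B> =
     (GREATEST K. transitive_group X K \<and> K \<subseteq> G \<and> block_system X K \<B>)"

definition three_half_closed :: "'a set \<Rightarrow> ('a \<Rightarrow> 'a) set \<Rightarrow> bool" where
  "three_half_closed X G \<longleftrightarrow>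
     five_half_closed X G \<and>
     (\<forall>H \<B>. transitive_group X H \<and> H \<subseteq> G \<and> normal_block_system X H \<B> \<longrightarrow>
        (let K = largest_with_blocks X G \<B> in
          fixer_block_system X K \<B> \<in> {\<B>, {X}} \<and>
          (fixer_block_system X H \<B> = \<B> \<and> \<B> \<noteq> {X} \<longrightarrow>
             (\<forall>B\<in>\<B>. induced (fix_group K \<B>) B = carrier (sym_on B)))))"

definition wreath ::
    "'a set \<Rightarrow> ('a \<Rightarrow> 'a) set \<Rightarrow> 'b set \<Rightarrow> ('b \<Rightarrow> 'b) set \<Rightarrow> ('a \<times> 'b \<Rightarrow> 'a \<times> 'b) set" where
  "wreath X G Y H =
     {f. f permutes X \<times> Y \<and>
         (\<exists>g\<in>G. \<exists>h. (\<forall>x\<in>X. h x \<in> H) \<and> (\<forall>x\<in>X. \<forall>y\<in>Y. f (x, y) = (g x, h x y)))}"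

definition perm_isomorphic ::
    "'a set \<Rightarrow> ('a \<Rightarrow> 'a) set \<Rightarrow> 'b set \<Rightarrow> ('b \<Rightarrow> 'b) set \<Rightarrow> bool" where
  "perm_isomorphic X G Y H \<longleftrightarrow>
     (\<exists>\<phi> \<psi>. bij_betw \<phi> X Y \<and> \<psi> \<in> iso (group_on X G) (group_on Y H) \<and>
        (\<forall>g\<in>G. \<forall>x\<in>X. \<phi> (g x) = \<psi> g (\<phi> x)))"

text \<open>
  A class of groups is a set of pairs \<open>(n, G)\<close> with \<open>G\<close> a permutation group on \<open>{..<n}\<close>; each class
  below is closed under permutation isomorphism.
\<close>

definition class_three_half :: "(nat \<times> (nat \<Rightarrow> nat) set) set" where
  "class_three_half = {(n, G). three_half_closed {..<n} G}"

definition class_K :: "(nat \<times> (nat \<Rightarrow> nat) set) set" where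
  "class_K = {(n, G). nine_eighth_closed {..<n} G}"

definition class_L :: "(nat \<times> (nat \<Rightarrow> nat) set) set" where
  "class_L = {(d, G). subgroup G (sym_on {..<d}) \<and>
     (\<exists>k K (n::nat). (k, K) \<in> class_K \<and> n \<ge> 2 \<and>
        perm_isomorphic {..<d} G
          ({..<k} \<times> {..<n}) (wreath {..<k} K {..<n} (carrier (sym_on {..<n}))))}"

text \<open>
  The trivial group \<open>1\<close> of degree 1 is \<open>9/8\<close>-closed, so \<open>S\<^sub>n = 1 \<wr> S\<^sub>n\<close> belongs to \<open>class_L\<close>
  for all \<open>n \<ge> 2\<close>. A transitive group of prime degree has only the two trivial block systems, whose
  fixer block system is the one-block partition, so for \<open>n\<close> prime \<open>S\<^sub>n\<close> belongs to \<open>class_K\<close> too.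
  Degree 1 cannot be excluded to avoid this overlap: \<open>S\<^sub>4\<close> is \<open>3/2\<close>-closed, is not \<open>9/8\<close>-closed
  (take the dihedral subgroup of order 8), and is primitive, hence no \<open>K \<wr> S\<^sub>n\<close> with \<open>K\<close> of degree
  at least 2 and \<open>n \<ge> 2\<close>.
\<close>

definition prime_symmetric_groups :: "(nat \<times> (nat \<Rightarrow> nat) set) set" where
  "prime_symmetric_groups = {(p, G). prime p \<and> G = carrier (sym_on {..<p})}"

end

theory Submission
  imports Defs "HOL-Library.Disjoint_Sets" "HOL-Algebra.Generated_Groups"
begin

text \<open>
  A wreath product \<open>K \<wr> S\<^sub>n\<close> with base set \<open>Z\<close> of \<open>K\<close> is the group of all permutations of \<open>X\<close>
  that induce an element of \<open>K\<close> on \<open>Z\<close> along a surjection \<open>\<pi>\<close> from \<open>X\<close> to \<open>Z\<close> with all fibres of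
  size \<open>n\<close>.

  If \<open>G\<close> is 3/2-closed but not 9/8-closed, then some fixer block system of a pair \<open>(H, \<B>)\<close> is not
  \<open>{X}\<close>. The same holds for the largest subgroup of \<open>G\<close> preserving \<open>\<B>\<close>, so \<open>G\<close> contains the full
  symmetric group of every block. Hence \<open>G\<close> contains transpositions. Being swapped by a
  transposition in \<open>G\<close> is a \<open>G\<close>-invariant equivalence relation, and \<open>G\<close> is the pullback of its
  action on the classes. If that action were not 9/8-closed, the same argument upstairs would give a
  transposition in \<open>G\<close> between two different classes.

  Conversely, let \<open>G\<close> be the pullback of a 9/8-closed \<open>K\<close>. A nontrivial stabiliser for \<open>(H, \<B>)\<close>
  has trivial image in \<open>K\<close>, which forces every block of \<open>\<B>\<close> into a fibre of \<open>\<pi>\<close>, and \<open>G\<close> contains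
  all permutations that preserve the fibres.
\<close>

abbreviation inv' :: "('a \<Rightarrow> 'a) \<Rightarrow> 'a \<Rightarrow> 'a" where
  "inv' f \<equiv> Hilbert_Choice.inv f"

section \<open>Permutation groups and block systems\<close>

lemma sym_on_simps [simp]:
  "carrier (sym_on X) = {p. p permutes X}" "g \<otimes>\<^bsub>sym_on X\<^esub> h = g \<circ> h" "\<one>\<^bsub>sym_on X\<^esub> = id"
  by (simp_all add: sym_on_def)

lemma group_sym_on: "group (sym_on X)"
proof (rule groupI)
  fix p assume "p \<in> carrier (sym_on X)"
  then have "inv' p \<in> carrier (sym_on X)" "inv' p \<otimes>\<^bsub>sym_on X\<^esub> p = \<one>\<^bsub>sym_on X\<^esub>"
    by (simp_all add: permutes_inv permutes_inv_o)
  then show "\<exists>q\<in>carrier (sym_on X). q \<otimes>\<^bsub>sym_on X\<^esub> p = \<one>\<^bsub>sym_on X\<^esub>" by blast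
qed (auto intro: permutes_compose simp: comp_assoc)

lemma m_inv_sym_on: "p permutes X \<Longrightarrow> inv\<^bsub>sym_on X\<^esub> p = inv' p"
  by (rule group.inv_equality[OF group_sym_on]) (simp_all add: permutes_inv permutes_inv_o)

lemma subgroup_sym_on_iff:
  "subgroup G (sym_on X) \<longleftrightarrow>
     (\<forall>g\<in>G. g permutes X) \<and> id \<in> G \<and> (\<forall>g\<in>G. \<forall>h\<in>G. g \<circ> h \<in> G) \<and> (\<forall>g\<in>G. inv' g \<in> G)"
  (is "?L \<longleftrightarrow> ?R")
proof
  assume L: ?L
  have p: "\<forall>g\<in>G. g permutes X" using subgroup.subset[OF L] by auto
  then show ?R
    using subgroup.one_closed[OF L] subgroup.m_closed[OF L] subgroup.m_inv_closed[OF L]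
    by (metis m_inv_sym_on sym_on_simps(2,3))
next
  assume R: ?R
  then show ?L
    by (intro group.subgroupI[OF group_sym_on]) (auto simp: m_inv_sym_on)
qed

lemma subgroup_sym_onD:
  assumes "subgroup G (sym_on X)"
  shows "\<And>g. g \<in> G \<Longrightarrow> g permutes X" "id \<in> G" "\<And>g h. g \<in> G \<Longrightarrow> h \<in> G \<Longrightarrow> g \<circ> h \<in> G"
    "\<And>g. g \<in> G \<Longrightarrow> inv' g \<in> G"
  using assms by (simp_all add: subgroup_sym_on_iff)

lemma subgroup_sym_onI:
  assumes "\<And>g. g \<in> G \<Longrightarrow> g permutes X" "id \<in> G" "\<And>g h. g \<in> G \<Longrightarrow> h \<in> G \<Longrightarrow> g \<circ> h \<in> G"
    "\<And>g. g \<in> G \<Longrightarrow> inv' g \<in> G"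
  shows "subgroup G (sym_on X)"
  using assms by (simp add: subgroup_sym_on_iff)

lemma subgroup_group_on_iff:
  assumes "subgroup G (sym_on X)"
  shows "subgroup W (group_on X G) \<longleftrightarrow> subgroup W (sym_on X) \<and> W \<subseteq> G"
  using group.subgroup_incl[OF group_sym_on _ assms] group.incl_subgroup[OF group_sym_on assms]
    subgroup.subset[of W "group_on X G"] by auto

lemma normal_group_on_iff:
  assumes G: "subgroup G (sym_on X)"
  shows "N \<lhd> group_on X G \<longleftrightarrow>
    subgroup N (sym_on X) \<and> N \<subseteq> G \<and> (\<forall>g\<in>G. \<forall>n\<in>N. g \<circ> n \<circ> inv' g \<in> N)"
proof -
  have "inv\<^bsub>group_on X G\<^esub> g = inv' g" if "g \<in> G" for g
    using that group.m_inv_consistent[OF group_sym_on G] m_inv_sym_on subgroup_sym_onD(1)[OF G]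
    by metis
  then show ?thesis
    unfolding group.normal_inv_iff[OF group.subgroup_imp_group[OF group_sym_on G]]
      subgroup_group_on_iff[OF G] by auto
qed

lemma transitive_groupD:
  assumes "transitive_group X G"
  shows "finite X" "X \<noteq> {}" "subgroup G (sym_on X)"
    "\<And>x y. x \<in> X \<Longrightarrow> y \<in> X \<Longrightarrow> \<exists>g\<in>G. g x = y"
  using assms by (auto simp: transitive_group_def transitive_on_def)

lemma partition_on_eqI:
  assumes "partition_on X \<B>" "B \<in> \<B>" "B' \<in> \<B>" "x \<in> B" "x \<in> B'"
  shows "B = B'"
  using partition_onD2[OF assms(1)] assms(2-) by (auto simp: disjoint_def)

lemma partition_on_exists:
  assumes "partition_on X \<B>" "x \<in> X"
  obtains B where "B \<in> \<B>" "x \<in> B"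
  using assms by (auto simp: partition_on_def)

lemma partition_on_subset:
  assumes "partition_on X \<B>" "B \<in> \<B>"
  shows "B \<subseteq> X" "B \<noteq> {}"
  using assms by (auto simp: partition_on_def)

section \<open>Block systems and normal block systems as invariant partitions\<close>

text \<open>Translates of a block that meet must coincide: if \<open>g\<close> and \<open>h\<close>
  send \<open>B\<close> to meeting sets, then the image of \<open>B\<close> under
  \<open>inv' h \<circ> g\<close> meets \<open>B\<close>. Transitivity makes the translates cover
  \<open>X\<close>. Conversely, any class of an invariant partition is a block, and by transitivity
  its translates are all the classes.\<close>

lemma block_system_iff:
  assumes G: "transitive_group X G"
  shows "block_system X G \<B> \<longleftrightarrow> partition_on X \<B> \<and> (\<forall>g\<in>G. \<forall>B\<in>\<B>. g ` B \<in> \<B>)"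
  (is "?L \<longleftrightarrow> ?R")
proof
  note sub = subgroup_sym_onD[OF transitive_groupD(3)[OF G]]
  assume ?L
  then obtain B where B: "is_block X G B" and \<B>: "\<B> = {g ` B | g. g \<in> G}"
    by (auto simp: block_system_def)
  have inv: "\<forall>g\<in>G. \<forall>B\<in>\<B>. g ` B \<in> \<B>"
    unfolding \<B> using sub(3) by (force simp: image_image comp_def)
  have eq: "g ` B = h ` B" if gh: "g \<in> G" "h \<in> G" and x: "x \<in> g ` B" "x \<in> h ` B" for g h x
  proof -
    have p: "h permutes X" using sub gh by blast
    have "inv' h \<circ> g \<in> G" using sub gh by blast
    moreover have "inv' h x \<in> (inv' h \<circ> g) ` B \<inter> B"
      using x permutes_inverses[OF p] by (auto simp: image_comp[symmetric])
    \<comment> \<open>The block condition only shows that the image contains \<open>B\<close>;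
      equality then follows by comparing cardinalities of finite sets.\<close>
    ultimately have sub1: "(inv' h \<circ> g) ` B \<inter> B = B" using B by (fastforce simp: is_block_def)
    have "finite B" using B transitive_groupD(1)[OF G] finite_subset by (auto simp: is_block_def)
    moreover have "card ((inv' h \<circ> g) ` B) \<le> card B" using calculation by (rule card_image_le)
    ultimately have "(inv' h \<circ> g) ` B = B" using sub1 by (metis card_seteq finite_imageI inf_le1)
    then have "(h \<circ> (inv' h \<circ> g)) ` B = h ` B" by (metis image_comp)
    moreover have "h \<circ> (inv' h \<circ> g) = g" using permutes_inverses[OF p] by auto
    ultimately show ?thesis by simp
  qed
  have "\<Union>\<B> = X"
  proof (intro equalityI subsetI)
    fix x assume "x \<in> \<Union>\<B>"
    then show "x \<in> X"
      unfolding \<B> using B sub(1) permutes_in_image by (fastforce simp: is_block_def)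
  next
    fix x assume x: "x \<in> X"
    obtain b where b: "b \<in> B" "b \<in> X" using B by (auto simp: is_block_def)
    obtain g where "g \<in> G" "g b = x" using transitive_groupD(4)[OF G b(2) x] by blast
    then show "x \<in> \<Union>\<B>" unfolding \<B> using b by blast
  qed
  moreover have "disjoint \<B>"
    unfolding disjoint_def \<B> using eq by blast
  moreover have "{} \<notin> \<B>" unfolding \<B> using B by (auto simp: is_block_def)
  ultimately show ?R using inv by (simp add: partition_on_def)
next
  assume ?R
  then have part: "partition_on X \<B>" and inv: "\<And>g B. g \<in> G \<Longrightarrow> B \<in> \<B> \<Longrightarrow> g ` B \<in> \<B>" by auto
  obtain x where x: "x \<in> X" using transitive_groupD(2)[OF G] by blast
  obtain B where B: "B \<in> \<B>" "x \<in> B" using partition_on_exists[OF part x] .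
  have "is_block X G B"
    unfolding is_block_def using inv[OF _ B(1)] partition_on_eqI[OF part _ B(1)]
      partition_on_subset[OF part B(1)] by blast
  moreover have "\<B> = {g ` B | g. g \<in> G}"
  proof (intro equalityI subsetI)
    fix B' assume B': "B' \<in> \<B>"
    then obtain y where y: "y \<in> B'" "y \<in> X" using partition_on_subset[OF part] by blast
    obtain g where g: "g \<in> G" "g x = y" using transitive_groupD(4)[OF G x y(2)] by blast
    then have "g ` B = B'" using partition_on_eqI[OF part inv[OF g(1) B(1)] B'] B y by blast
    then show "B' \<in> {g ` B | g. g \<in> G}" using g by blast
  qed (use inv B in blast)
  ultimately show ?L by (auto simp: block_system_def)
qed

lemma block_systemD:
  assumes "transitive_group X G" "block_system X G \<B>"
  shows "partition_on X \<B>" "\<And>g B. g \<in> G \<Longrightarrow> B \<in> \<B> \<Longrightarrow> g ` B \<in> \<B>"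
  using assms block_system_iff by blast+

lemma subgroup_fix_group:
  assumes "subgroup G (sym_on X)"
  shows "subgroup (fix_group G \<B>) (sym_on X)"
proof (rule subgroup_sym_onI)
  note sub = subgroup_sym_onD[OF assms]
  fix g assume g: "g \<in> fix_group G \<B>"
  have p: "g permutes X" using g sub by (auto simp: fix_group_def)
  have "inv' g ` B = B" if "B \<in> \<B>" for B
  proof -
    have "inv' g ` B = inv' g ` g ` B" using g that by (simp add: fix_group_def)
    then show ?thesis using permutes_inverses(2)[OF p] by (simp add: image_image)
  qed
  then show "inv' g \<in> fix_group G \<B>" using g sub by (auto simp: fix_group_def)
next
  fix g h assume "g \<in> fix_group G \<B>" "h \<in> fix_group G \<B>"
  then show "g \<circ> h \<in> fix_group G \<B>"
    using subgroup_sym_onD(3)[OF assms] unfolding fix_group_def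
    by (simp add: image_image[symmetric, of g h])
qed (use subgroup_sym_onD[OF assms] in \<open>auto simp: fix_group_def\<close>)

text \<open>Any normal subgroup with orbit set \<open>\<B>\<close> lies in the kernel
  \<open>fix_group G \<B>\<close>, and this kernel is itself normal in \<open>G\<close>. So the
  normal subgroup may be taken to be the kernel, and normality of \<open>\<B>\<close> becomes
  transitivity of the kernel on each block.\<close>

lemma normal_block_system_iff:
  assumes G: "transitive_group X G"
  shows "normal_block_system X G \<B> \<longleftrightarrow> partition_on X \<B> \<and> (\<forall>g\<in>G. \<forall>B\<in>\<B>. g ` B \<in> \<B>) \<and>
    (\<forall>B\<in>\<B>. \<forall>x\<in>B. \<forall>y\<in>B. \<exists>g\<in>fix_group G \<B>. g x = y)"
  (is "?L \<longleftrightarrow> ?R")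
proof
  note GS = transitive_groupD(3)[OF G]
  note sub = subgroup_sym_onD[OF GS]
  assume L: ?L
  then have bs: "block_system X G \<B>" by (simp add: normal_block_system_def)
  obtain N where "N \<lhd> group_on X G" and orb: "\<B> = orbits (group_on X N) X (\<lambda>g. g)"
    using L unfolding normal_block_system_def by blast
  then have N: "subgroup N (sym_on X)" "N \<subseteq> G" by (simp_all add: normal_group_on_iff[OF GS])
  note subN = subgroup_sym_onD[OF N(1)]
  have \<B>: "\<B> = {{n x | n. n \<in> N} | x. x \<in> X}" by (simp add: orb orbits_def orbit_def)
  have "n ` B = B" if n: "n \<in> N" and B: "B \<in> \<B>" for n B
  proof -
    obtain x where x: "B = {m x | m. m \<in> N}" using B \<B> by auto
    have *: "n ` B \<subseteq> B" if "n \<in> N" for n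
    proof
      fix y assume "y \<in> n ` B"
      then obtain m where m: "m \<in> N" "y = (n \<circ> m) x" by (auto simp: x)
      then show "y \<in> B" unfolding x using subN(3)[OF that m(1)] by blast
    qed
    have "B = n ` inv' n ` B"
      using permutes_inverses(1)[OF subN(1)[OF n]] by (auto simp: image_image)
    then show ?thesis using *[OF n] *[OF subN(4)[OF n]] by blast
  qed
  then have NF: "N \<subseteq> fix_group G \<B>" using N by (auto simp: fix_group_def)
  have tr: "\<exists>g\<in>N. g x = y" if B: "B \<in> \<B>" and x: "x \<in> B" and y: "y \<in> B" for B x y
  proof -
    obtain z m m' where m: "m \<in> N" "m' \<in> N" "x = m z" "y = m' z" using B x y \<B> by auto
    then have "(m' \<circ> inv' m) x = y" using permutes_inverses(2)[OF subN(1)[OF m(1)]] by simp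
    then show ?thesis using subN(3)[OF m(2) subN(4)[OF m(1)]] by (intro bexI)
  qed
  show ?R
  proof (intro conjI ballI)
    show "partition_on X \<B>" by (rule block_systemD(1)[OF G bs])
    show "g ` B \<in> \<B>" if "g \<in> G" "B \<in> \<B>" for g B by (rule block_systemD(2)[OF G bs that])
    show "\<exists>g\<in>fix_group G \<B>. g x = y" if "B \<in> \<B>" "x \<in> B" "y \<in> B" for B x y
      using tr[OF that] NF by blast
  qed
next
  note GS = transitive_groupD(3)[OF G]
  note sub = subgroup_sym_onD[OF GS]
  assume R: ?R
  then have part: "partition_on X \<B>" and inv: "\<And>g B. g \<in> G \<Longrightarrow> B \<in> \<B> \<Longrightarrow> g ` B \<in> \<B>"
    and tr: "\<And>B x y. B \<in> \<B> \<Longrightarrow> x \<in> B \<Longrightarrow> y \<in> B \<Longrightarrow> \<exists>g\<in>fix_group G \<B>. g x = y" by auto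
  let ?N = "fix_group G \<B>"
  have "g \<circ> n \<circ> inv' g \<in> ?N" if g: "g \<in> G" and n: "n \<in> ?N" for g n
  proof -
    have "(g \<circ> n \<circ> inv' g) ` B = B" if "B \<in> \<B>" for B
    proof -
      have "inv' g ` B \<in> \<B>" using inv[OF sub(4)[OF g] that] .
      then have "n ` inv' g ` B = inv' g ` B" using n by (auto simp: fix_group_def)
      then have "(g \<circ> n \<circ> inv' g) ` B = g ` inv' g ` B" by (metis image_comp)
      also have "\<dots> = B" using permutes_inverses(1)[OF sub(1)[OF g]] by (auto simp: image_image)
      finally show ?thesis .
    qed
    moreover have "g \<circ> n \<circ> inv' g \<in> G"
      using n sub(3)[OF sub(3)[OF g] sub(4)[OF g]] by (simp add: fix_group_def)
    ultimately show ?thesis by (simp add: fix_group_def)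
  qed
  then have "?N \<lhd> group_on X G"
    unfolding normal_group_on_iff[OF GS] using subgroup_fix_group[OF GS]
    by (simp add: fix_group_def)
  moreover have "\<B> = orbits (group_on X ?N) X (\<lambda>g. g)"
  proof -
    have *: "{n x | n. n \<in> ?N} = B" if "B \<in> \<B>" "x \<in> B" for B x
    proof
      show "B \<subseteq> {n x | n. n \<in> ?N}" using tr[OF that] by fastforce
      show "{n x | n. n \<in> ?N} \<subseteq> B" using that by (auto simp: fix_group_def)
    qed
    have "\<B> = {{n x | n. n \<in> ?N} | x. x \<in> X}"
    proof (intro equalityI subsetI)
      fix B assume B: "B \<in> \<B>"
      then obtain x where x: "x \<in> B" "x \<in> X" using partition_on_subset[OF part] by blast
      show "B \<in> {{n x | n. n \<in> ?N} | x. x \<in> X}"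
        by (rule CollectI, rule exI[of _ x]) (simp add: *[OF B x(1)] x(2))
    next
      fix B assume "B \<in> {{n x | n. n \<in> ?N} | x. x \<in> X}"
      then obtain x where x: "x \<in> X" "B = {n x | n. n \<in> ?N}" by blast
      obtain B' where B': "B' \<in> \<B>" "x \<in> B'" using partition_on_exists[OF part x(1)] .
      show "B \<in> \<B>" unfolding x(2) *[OF B'] by (rule B'(1))
    qed
    then show ?thesis by (simp add: orbits_def orbit_def)
  qed
  ultimately show ?L
    unfolding normal_block_system_def block_system_iff[OF G] using part inv by blast
qed

lemma normal_block_systemD:
  assumes "transitive_group X G" "normal_block_system X G \<B>"
  shows "block_system X G \<B>" "partition_on X \<B>" "\<And>g B. g \<in> G \<Longrightarrow> B \<in> \<B> \<Longrightarrow> g ` B \<in> \<B>"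
    "\<And>B x y. B \<in> \<B> \<Longrightarrow> x \<in> B \<Longrightarrow> y \<in> B \<Longrightarrow> \<exists>g\<in>fix_group G \<B>. g x = y"
proof -
  note R = normal_block_system_iff[THEN iffD1, OF assms]
  show "block_system X G \<B>" using assms(2) by (simp add: normal_block_system_def)
  show "partition_on X \<B>" using R by blast
  show "\<And>g B. g \<in> G \<Longrightarrow> B \<in> \<B> \<Longrightarrow> g ` B \<in> \<B>" using R by blast
  show "\<And>B x y. B \<in> \<B> \<Longrightarrow> x \<in> B \<Longrightarrow> y \<in> B \<Longrightarrow> \<exists>g\<in>fix_group G \<B>. g x = y" using R by blast
qed

section \<open>Stabilisers and the fixer block system\<close>

text \<open>Unfolds \<open>induced\<close> into statements about points. The final alternative may
  range over all of \<open>\<B>\<close>, because \<open>B\<close> itself falls under its second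
  case.\<close>

lemma wstab_cond_iff:
  assumes "subgroup G (sym_on X)"
  shows "wstab_cond X G \<B> B W \<longleftrightarrow>
    subgroup W (sym_on X) \<and> W \<subseteq> fix_group G \<B> \<and> (\<forall>w\<in>W. \<forall>x\<in>B. w x = x) \<and>
    (\<forall>B'\<in>\<B>. (\<forall>x\<in>B'. \<forall>y\<in>B'. \<exists>w\<in>W. w x = y) \<or> (\<forall>w\<in>W. \<forall>x\<in>B'. w x = x))"
proof (cases "subgroup W (sym_on X)")
  case True
  have ind: "induced W B = (\<lambda>w. restrict_id w B) ` W" for B by (auto simp: induced_def)
  have img: "f ` W = {c} \<longleftrightarrow> (\<forall>w\<in>W. f w = c)" for f :: "('a \<Rightarrow> 'a) \<Rightarrow> 'a \<Rightarrow> 'a" and c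
    using rev_image_eqI[OF subgroup_sym_onD(2)[OF True], of _ f] subgroup_sym_onD(2)[OF True] by auto
  have triv: "restrict_id w B = id \<longleftrightarrow> (\<forall>x\<in>B. w x = x)" for w :: "'a \<Rightarrow> 'a" and B
    by (auto simp: fun_eq_iff restrict_id_def)
  define T where "T A \<longleftrightarrow> (\<forall>x\<in>A. \<forall>y\<in>A. \<exists>w\<in>W. w x = y)" for A
  define F where "F A \<longleftrightarrow> (\<forall>w\<in>W. \<forall>x\<in>A. w x = x)" for A
  have "induced W A = {id} \<longleftrightarrow> F A" "transitive_on A (induced W A) \<longleftrightarrow> T A" for A
    by (simp_all only: ind img triv transitive_on_def T_def F_def) simp
  then have "wstab_cond X G \<B> B W \<longleftrightarrow>
    subgroup W (sym_on X) \<and> W \<subseteq> fix_group G \<B> \<and> F B \<and> (\<forall>B'\<in>\<B>. T B' \<or> F B')"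
    unfolding wstab_cond_def subgroup_group_on_iff[OF subgroup_fix_group[OF assms]] by auto
  then show ?thesis by (simp only: T_def F_def)
next
  case False
  then show ?thesis
    unfolding wstab_cond_def subgroup_group_on_iff[OF subgroup_fix_group[OF assms]] by simp
qed

lemma wstab_condD:
  assumes "subgroup G (sym_on X)" "wstab_cond X G \<B> B W"
  shows "subgroup W (sym_on X)" "W \<subseteq> fix_group G \<B>" "\<And>w x. w \<in> W \<Longrightarrow> x \<in> B \<Longrightarrow> w x = x"
    "\<And>B'. B' \<in> \<B> \<Longrightarrow> (\<forall>x\<in>B'. \<forall>y\<in>B'. \<exists>w\<in>W. w x = y) \<or> (\<forall>w\<in>W. \<forall>x\<in>B'. w x = x)"
  using assms(2) unfolding wstab_cond_iff[OF assms(1)] by simp_all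

text \<open>The greatest element is the subgroup \<open>V\<close> generated by all admissible
  \<open>W\<close>. On a block \<open>B'\<close>, either some \<open>W\<close> moves a point, so
  that \<open>W\<close> and hence \<open>V\<close> is transitive there, or every generator fixes
  \<open>B'\<close> pointwise, and so does \<open>V\<close>. This gives the \<open>GREATEST\<close>
  in \<open>wstab\<close> its intended meaning.\<close>

lemma wstab_greatest:
  fixes X :: "'a set"
  assumes G: "subgroup G (sym_on X)"
  shows "wstab_cond X G \<B> B (wstab X G \<B> B)"
    and "\<And>W. wstab_cond X G \<B> B W \<Longrightarrow> W \<subseteq> wstab X G \<B> B"
proof -
  let ?U = "\<Union>{W. wstab_cond X G \<B> B W}"
  define V :: "('a \<Rightarrow> 'a) set" where "V = generate (sym_on X) ?U"
  have UF: "?U \<subseteq> fix_group G \<B>" using wstab_condD(2)[OF G] by blast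
  have FS: "fix_group G \<B> \<subseteq> carrier (sym_on X)"
    using subgroup.subset[OF subgroup_fix_group[OF G]] .
  have V: "subgroup V (sym_on X)"
    unfolding V_def by (rule group.generate_is_subgroup[OF group_sym_on]) (use UF FS in blast)
  have VF: "V \<subseteq> fix_group G \<B>"
    unfolding V_def
    by (rule group.generate_subgroup_incl[OF group_sym_on UF subgroup_fix_group[OF G]])
  have UV: "W \<subseteq> V" if "wstab_cond X G \<B> B W" for W
    unfolding V_def using that by (auto intro: generate.incl)
  \<comment> \<open>The pointwise stabiliser of \<open>A\<close> in the symmetric group is a
    subgroup, so it contains \<open>V\<close> as soon as it contains the generators.\<close>
  have pt: "\<forall>v\<in>V. \<forall>x\<in>A. v x = x" if "\<And>W w x. wstab_cond X G \<B> B W \<Longrightarrow> w \<in> W \<Longrightarrow> x \<in> A \<Longrightarrow> w x = x" for A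
  proof -
    let ?S = "{p. p permutes X \<and> (\<forall>x\<in>A. p x = x)}"
    have "subgroup ?S (sym_on X)"
    proof (rule subgroup_sym_onI)
      fix g assume "g \<in> ?S"
      then show "inv' g \<in> ?S" using permutes_inv[of g X] permutes_inv_eq[of g X] by simp
    next
      fix g h assume "g \<in> ?S" "h \<in> ?S"
      then show "g \<circ> h \<in> ?S" using permutes_compose[of h X g] by simp
    qed simp_all
    moreover have "?U \<subseteq> ?S"
    proof
      fix w assume "w \<in> ?U"
      then show "w \<in> ?S" using that UF FS by fastforce
    qed
    ultimately have "V \<subseteq> ?S"
      unfolding V_def by (intro group.generate_subgroup_incl[OF group_sym_on])
    then show ?thesis by blast
  qed
  have "(\<forall>x\<in>B'. \<forall>y\<in>B'. \<exists>w\<in>V. w x = y) \<or> (\<forall>w\<in>V. \<forall>x\<in>B'. w x = x)" if B': "B' \<in> \<B>" for B'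
  proof (cases "\<exists>W w x. wstab_cond X G \<B> B W \<and> w \<in> W \<and> x \<in> B' \<and> w x \<noteq> x")
    case True
    then obtain W w x where W: "wstab_cond X G \<B> B W" "w \<in> W" "x \<in> B'" "w x \<noteq> x" by blast
    then show ?thesis using wstab_condD(4)[OF G W(1) B'] UV[OF W(1)] by blast
  next
    case False
    then have "\<forall>w\<in>V. \<forall>x\<in>B'. w x = x" by (intro pt) blast
    then show ?thesis by blast
  qed
  then have VC: "wstab_cond X G \<B> B V"
    unfolding wstab_cond_iff[OF G] using V VF pt[of B] wstab_condD(3)[OF G, of \<B> B] by simp
  have "wstab X G \<B> B = V"
    unfolding wstab_def by (rule Greatest_equality) (use VC UV in auto)
  then show "wstab_cond X G \<B> B (wstab X G \<B> B)"
    and "\<And>W. wstab_cond X G \<B> B W \<Longrightarrow> W \<subseteq> wstab X G \<B> B" using VC UV by auto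
qed

text \<open>If all groups \<open>wstab X G \<B> B\<close> agree, then their common value fixes every block pointwise.\<close>

lemma fixer_block_system_eq_singleton_iff:
  assumes G: "subgroup G (sym_on X)" and part: "partition_on X \<B>" and X: "X \<noteq> {}"
  shows "fixer_block_system X G \<B> = {X} \<longleftrightarrow> (\<forall>B\<in>\<B>. \<forall>W. wstab_cond X G \<B> B W \<longrightarrow> W = {id})"
  (is "?L \<longleftrightarrow> ?R")
proof
  let ?R = "{(B, B'). B \<in> \<B> \<and> B' \<in> \<B> \<and> wstab X G \<B> B = wstab X G \<B> B'}"
  assume L: ?L
  show "\<forall>B\<in>\<B>. \<forall>W. wstab_cond X G \<B> B W \<longrightarrow> W = {id}"
  proof (intro ballI allI impI)
    fix B W assume B: "B \<in> \<B>" and W: "wstab_cond X G \<B> B W"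
    have "wstab X G \<B> B' = wstab X G \<B> B" if B': "B' \<in> \<B>" for B'
    proof -
      have "\<Union>(?R `` {B}) \<in> fixer_block_system X G \<B>"
        unfolding fixer_block_system_def by (intro imageI quotientI B)
      then have "\<Union>(?R `` {B}) = X" using L by simp
      moreover obtain x where x: "x \<in> B'" "x \<in> X" using partition_on_subset[OF part B'] by blast
      ultimately obtain B'' where "(B, B'') \<in> ?R" "x \<in> B''" by blast
      moreover from this have "B'' = B'" using partition_on_eqI[OF part _ B' _ x(1)] by simp
      ultimately show ?thesis by simp
    qed
    then have *: "w x = x" if "w \<in> W" "x \<in> B'" "B' \<in> \<B>" for w x B'
      using that wstab_greatest(2)[OF G W] wstab_condD(3)[OF G wstab_greatest(1)[OF G, of \<B> B']]
      by blast
    have "w x = x" if w: "w \<in> W" for w x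
    proof (cases "x \<in> X")
      case True
      then obtain B' where "B' \<in> \<B>" "x \<in> B'" using partition_on_exists[OF part] by blast
      then show ?thesis using * w by blast
    next
      case False
      then show ?thesis
        using permutes_not_in[OF subgroup_sym_onD(1)[OF wstab_condD(1)[OF G W] w]] by blast
    qed
    then have "\<forall>w\<in>W. w = id" by auto
    then show "W = {id}" using subgroup_sym_onD(2)[OF wstab_condD(1)[OF G W]] by blast
  qed
next
  assume R: ?R
  then have "wstab X G \<B> B = {id}" if "B \<in> \<B>" for B using wstab_greatest(1)[OF G] that by blast
  moreover have "\<B> \<noteq> {}" "\<Union>\<B> = X" using part X by (auto simp: partition_on_def)
  ultimately show ?L
    by (auto simp: fixer_block_system_def quotient_def image_def)
qed

lemma fixer_block_system_eq_self:
  assumes "partition_on X \<B>" "inj_on (wstab X G \<B>) \<B>"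
  shows "fixer_block_system X G \<B> = \<B>"
proof -
  have "{(B, B'). B \<in> \<B> \<and> B' \<in> \<B> \<and> wstab X G \<B> B = wstab X G \<B> B'} `` {B} = {B}" if "B \<in> \<B>" for B
    using that assms(2) by (auto dest: inj_onD)
  then show ?thesis unfolding fixer_block_system_def quotient_def by auto
qed

lemma fixer_block_system_Union:
  assumes "E \<in> fixer_block_system X G \<B>"
  obtains S where "S \<subseteq> \<B>" "E = \<Union>S"
proof -
  let ?R = "{(B, B'). B \<in> \<B> \<and> B' \<in> \<B> \<and> wstab X G \<B> B = wstab X G \<B> B'}"
  obtain S where S: "S \<in> \<B> // ?R" "E = \<Union>S" using assms by (auto simp: fixer_block_system_def)
  have "S \<subseteq> \<B>" using S(1) by (auto elim!: quotientE)
  then show ?thesis using that S(2) by blast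
qed

text \<open>When every fixer block system is \<open>{X}\<close>, the 5/2 condition holds by itself:
  the only possible \<open>E\<close> is \<open>X\<close>, and restricting \<open>g\<close> to
  \<open>X\<close> gives back \<open>g\<close>. What remains is that all stabilisers are
  trivial.\<close>

lemma nine_eighth_closed_iff:
  "nine_eighth_closed X G \<longleftrightarrow> transitive_group X G \<and>
    (\<forall>H \<B> B W. transitive_group X H \<and> H \<subseteq> G \<and> normal_block_system X H \<B> \<and> B \<in> \<B> \<and>
       wstab_cond X H \<B> B W \<longrightarrow> W = {id})"
  (is "?L \<longleftrightarrow> ?R")
proof -
  have single: "fixer_block_system X H \<B> = {X} \<longleftrightarrow> (\<forall>B\<in>\<B>. \<forall>W. wstab_cond X H \<B> B W \<longrightarrow> W = {id})"
    if "transitive_group X H" "normal_block_system X H \<B>" for H \<B>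
    by (rule fixer_block_system_eq_singleton_iff[OF transitive_groupD(3)[OF that(1)]
          normal_block_systemD(2)[OF that] transitive_groupD(2)[OF that(1)]])
  show ?thesis
  proof
    assume ?L
    then have "transitive_group X G" and
      "\<And>H \<B>. transitive_group X H \<Longrightarrow> H \<subseteq> G \<Longrightarrow> normal_block_system X H \<B> \<Longrightarrow>
         fixer_block_system X H \<B> = {X}"
      unfolding nine_eighth_closed_def five_half_closed_def by simp_all
    then show ?R using single by metis
  next
    assume R: ?R
    have eq: "fixer_block_system X H \<B> = {X}"
      if "transitive_group X H" "H \<subseteq> G" "normal_block_system X H \<B>" for H \<B>
      unfolding single[OF that(1,3)] using R that by metis
    have tr: "transitive_group X G" using R by blast
    have "restrict_id g X = g" if "g \<in> G" for g
      using permutes_not_in[OF subgroup_sym_onD(1)[OF transitive_groupD(3)[OF tr] that]]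
      by (auto simp: fun_eq_iff restrict_id_def)
    then show ?L
      unfolding nine_eighth_closed_def five_half_closed_def using tr eq by (metis singletonD)
  qed
qed

text \<open>The elements of \<open>G\<close> mapping blocks to blocks are closed under inverses
  because an injective self-map of the finite set \<open>\<B>\<close> is onto, and they inherit
  transitivity from \<open>H\<close>. This turns the \<open>GREATEST\<close> in
  \<open>largest_with_blocks\<close> into an explicit set.\<close>

lemma largest_with_blocks_eq:
  assumes G: "subgroup G (sym_on X)" and H: "transitive_group X H" "H \<subseteq> G" "block_system X H \<B>"
  shows "largest_with_blocks X G \<B> = {g \<in> G. \<forall>B\<in>\<B>. g ` B \<in> \<B>}" (is "_ = ?K")
    and "transitive_group X {g \<in> G. \<forall>B\<in>\<B>. g ` B \<in> \<B>}"
    and "block_system X {g \<in> G. \<forall>B\<in>\<B>. g ` B \<in> \<B>} \<B>"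
proof -
  note sub = subgroup_sym_onD[OF G]
  note part = block_systemD(1)[OF H(1,3)]
  have HK: "H \<subseteq> ?K" using H block_systemD[OF H(1,3)] by blast
  have fin: "finite \<B>" using finite_elements part transitive_groupD(1)[OF H(1)] by blast
  have "subgroup ?K (sym_on X)"
  proof (rule subgroup_sym_onI)
    fix g assume g: "g \<in> ?K"
    have p: "g permutes X" using g sub by blast
    have "inv' g ` B \<in> \<B>" if B: "B \<in> \<B>" for B
    proof -
      have "inj_on ((`) g) \<B>" using permutes_inj[OF p] inj_image_eq_iff by (metis inj_onI)
      moreover have "(`) g ` \<B> \<subseteq> \<B>" using g by blast
      ultimately have "(`) g ` \<B> = \<B>" using fin by (simp add: endo_inj_surj)
      then obtain B' where "B' \<in> \<B>" "B = g ` B'" using B by blast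
      then show ?thesis using permutes_inverses(2)[OF p] by (simp add: image_image)
    qed
    then show "inv' g \<in> ?K" using g sub by blast
  next
    fix g h assume "g \<in> ?K" "h \<in> ?K"
    then show "g \<circ> h \<in> ?K" using sub(3) by (simp add: image_image[symmetric, of g h])
  qed (use sub in auto)
  then show tK: "transitive_group X ?K"
    using H(1) HK unfolding transitive_group_def transitive_on_def by blast
  show bK: "block_system X ?K \<B>" using block_system_iff[OF tK] part by blast
  show "largest_with_blocks X G \<B> = ?K"
    unfolding largest_with_blocks_def
  proof (rule Greatest_equality)
    fix K' assume "transitive_group X K' \<and> K' \<subseteq> G \<and> block_system X K' \<B>"
    then show "K' \<subseteq> ?K" using block_systemD by blast
  qed (use tK bK in blast)
qed

section \<open>Pulling back and pushing forward along a map\<close>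

definition pullback :: "('a \<Rightarrow> 'b) \<Rightarrow> 'a set \<Rightarrow> ('b \<Rightarrow> 'b) set \<Rightarrow> ('a \<Rightarrow> 'a) set" where
  "pullback \<pi> X K = {p. p permutes X \<and> (\<exists>k\<in>K. \<forall>x\<in>X. \<pi> (p x) = k (\<pi> x))}"

text \<open>Requiring \<open>k\<close> to permute the image of \<open>\<pi>\<close> fixes its values
  elsewhere, so each \<open>g\<close> contributes at most one \<open>k\<close>. An element of
  \<open>G\<close> that does not respect the fibres contributes none.\<close>

definition pushforward :: "('a \<Rightarrow> 'b) \<Rightarrow> 'a set \<Rightarrow> ('a \<Rightarrow> 'a) set \<Rightarrow> ('b \<Rightarrow> 'b) set" where
  "pushforward \<pi> X G = {k. k permutes \<pi> ` X \<and> (\<exists>g\<in>G. \<forall>x\<in>X. \<pi> (g x) = k (\<pi> x))}"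

definition equal_fibres :: "('a \<Rightarrow> 'b) \<Rightarrow> 'a set \<Rightarrow> nat \<Rightarrow> bool" where
  "equal_fibres \<pi> X n \<longleftrightarrow> finite X \<and> (\<forall>z\<in>\<pi> ` X. card {x \<in> X. \<pi> x = z} = n)"

lemma pullback_mono: "K \<subseteq> K' \<Longrightarrow> pullback \<pi> X K \<subseteq> pullback \<pi> X K'"
  by (auto simp: pullback_def)

lemma permutes_eqI:
  assumes "p permutes X" "q permutes X" "\<And>x. x \<in> X \<Longrightarrow> p x = q x"
  shows "p = q"
proof
  fix x show "p x = q x"
    using assms(3) permutes_not_in[OF assms(1)] permutes_not_in[OF assms(2)] by (cases "x \<in> X") simp_all
qed

text \<open>The fibres over \<open>z\<close> and \<open>k z\<close> have the same size, so
  bijections between them glue to a permutation over \<open>k\<close>; over \<open>T\<close> they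
  are chosen to be the identity. Empty \<open>T\<close> yields transitivity of pullbacks; taking the
  common fixed points of a group for \<open>T\<close> allows stabilisers to be lifted.\<close>

lemma permutes_lift:
  assumes fib: "equal_fibres \<pi> X n" and k: "k permutes \<pi> ` X" and T: "\<And>z. z \<in> T \<Longrightarrow> k z = z"
    and a: "a \<in> X" "\<pi> a \<notin> T" and b: "b \<in> X" "\<pi> b = k (\<pi> a)"
  obtains p where "p permutes X" "\<And>x. x \<in> X \<Longrightarrow> \<pi> (p x) = k (\<pi> x)"
    "\<And>x. x \<in> X \<Longrightarrow> \<pi> x \<in> T \<Longrightarrow> p x = x" "p a = b"
proof -
  let ?F = "\<lambda>z. {x \<in> X. \<pi> x = z}"
  have fin: "finite X" using fib by (simp add: equal_fibres_def)
  have "\<exists>f. bij_betw f (?F z) (?F (k z)) \<and> (z \<in> T \<longrightarrow> f = id)" if z: "z \<in> \<pi> ` X" for z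
  proof (cases "z \<in> T")
    case True
    then show ?thesis using T[OF True] by (intro exI[of _ id]) simp
  next
    case False
    have "card (?F z) = card (?F (k z))"
      using fib z permutes_in_image[OF k, of z] unfolding equal_fibres_def by metis
    moreover have "finite (?F z)" "finite (?F (k z))" using fin by simp_all
    ultimately show ?thesis using False finite_same_card_bij by metis
  qed
  then obtain f where f: "\<And>z. z \<in> \<pi> ` X \<Longrightarrow> bij_betw (f z) (?F z) (?F (k z))"
    and fT: "\<And>z. z \<in> \<pi> ` X \<Longrightarrow> z \<in> T \<Longrightarrow> f z = id"
    by metis
  define q where "q x = (if x \<in> X then f (\<pi> x) x else x)" for x
  have q: "q x \<in> X" "\<pi> (q x) = k (\<pi> x)" if "x \<in> X" for x
    using bij_betw_apply[OF f, of "\<pi> x" x] that by (auto simp: q_def)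
  have "inj_on q X"
  proof (rule inj_onI)
    fix x y assume xy: "x \<in> X" "y \<in> X" "q x = q y"
    then have "k (\<pi> x) = k (\<pi> y)" using q(2) by metis
    then have e: "\<pi> x = \<pi> y" using permutes_inj[OF k] by (simp add: inj_eq)
    then show "x = y"
      using bij_betw_imp_inj_on[OF f, of "\<pi> x"] xy by (auto simp: q_def inj_on_def)
  qed
  then have qp: "q permutes X"
    by (rule inj_imp_permutes) (use fin q in \<open>auto simp: q_def\<close>)
  \<comment> \<open>\<open>q a\<close> and \<open>b\<close> lie in one fibre, so the swap keeps the
    induced map \<open>k\<close> and sends \<open>a\<close> to \<open>b\<close>. As \<open>k\<close>
    is injective and \<open>\<pi> a\<close> lies outside \<open>T\<close>, no point over
    \<open>T\<close> is affected.\<close>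
  define p where "p = transpose (q a) b \<circ> q"
  have p: "p x = (if x = a then b else if q x = b then q a else q x)" for x
    using permutes_inj[OF qp] by (auto simp: p_def transpose_def inj_eq)
  have inj: "k z = k z' \<longleftrightarrow> z = z'" for z z' using permutes_inj[OF k] by (simp add: inj_eq)
  show ?thesis
  proof
    show "p permutes X" unfolding p_def
      using q(1)[OF a(1)] b(1) qp by (intro permutes_compose permutes_swap_id)
    show "\<pi> (p x) = k (\<pi> x)" if "x \<in> X" for x
    proof -
      have "k (\<pi> x) = k (\<pi> a)" if "q x = b" using q(2)[OF \<open>x \<in> X\<close>] b that by simp
      then show ?thesis using q(2)[OF that] q(2)[OF a(1)] b by (auto simp: p)
    qed
    show "p x = x" if x: "x \<in> X" "\<pi> x \<in> T" for x
    proof -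
      have qx: "q x = x" using fT x by (simp add: q_def)
      have "x \<noteq> a" using x a by blast
      moreover have "x \<noteq> b" using x a b T[OF x(2)] inj by metis
      ultimately show ?thesis using qx by (simp add: p)
    qed
    show "p a = b" by (simp add: p)
  qed
qed

lemma subgroup_pullback:
  assumes K: "subgroup K (sym_on (\<pi> ` X))"
  shows "subgroup (pullback \<pi> X K) (sym_on X)"
proof (rule subgroup_sym_onI)
  note subK = subgroup_sym_onD[OF K]
  show "g permutes X" if "g \<in> pullback \<pi> X K" for g using that by (simp add: pullback_def)
  show "id \<in> pullback \<pi> X K" using subK(2) by (auto simp: pullback_def intro!: bexI[of _ id])
  fix g assume "g \<in> pullback \<pi> X K"
  then obtain k where g: "g permutes X" and k: "k \<in> K" "\<And>x. x \<in> X \<Longrightarrow> \<pi> (g x) = k (\<pi> x)"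
    by (auto simp: pullback_def)
  have "\<pi> (inv' g x) = inv' k (\<pi> x)" if "x \<in> X" for x
  proof -
    have "inv' g x \<in> X" using permutes_in_image[OF permutes_inv[OF g]] that by simp
    then have "\<pi> x = k (\<pi> (inv' g x))" using k(2) permutes_inverses(1)[OF g] by metis
    then show ?thesis using permutes_inverses(2)[OF subK(1)[OF k(1)]] by simp
  qed
  then show "inv' g \<in> pullback \<pi> X K"
    using permutes_inv[OF g] subK(4)[OF k(1)] unfolding pullback_def by blast
  fix h assume "h \<in> pullback \<pi> X K"
  then obtain l where h: "h permutes X" and l: "l \<in> K" "\<And>x. x \<in> X \<Longrightarrow> \<pi> (h x) = l (\<pi> x)"
    by (auto simp: pullback_def)
  have "\<pi> ((g \<circ> h) x) = (k \<circ> l) (\<pi> x)" if "x \<in> X" for x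
    using k(2)[of "h x"] l(2)[OF that] permutes_in_image[OF h] that by simp
  then show "g \<circ> h \<in> pullback \<pi> X K"
    using permutes_compose[OF h g] subK(3)[OF k(1) l(1)] unfolding pullback_def by blast
qed

lemma subgroup_pushforward:
  assumes G: "subgroup G (sym_on X)"
  shows "subgroup (pushforward \<pi> X G) (sym_on (\<pi> ` X))"
proof (rule subgroup_sym_onI)
  note subG = subgroup_sym_onD[OF G]
  show "k permutes \<pi> ` X" if "k \<in> pushforward \<pi> X G" for k using that by (simp add: pushforward_def)
  show "id \<in> pushforward \<pi> X G" using subG(2) by (auto simp: pushforward_def intro!: bexI[of _ id])
  fix k assume "k \<in> pushforward \<pi> X G"
  then obtain g where k: "k permutes \<pi> ` X" and g: "g \<in> G" "\<And>x. x \<in> X \<Longrightarrow> \<pi> (g x) = k (\<pi> x)"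
    by (auto simp: pushforward_def)
  note gp = subG(1)[OF g(1)]
  have "\<pi> (inv' g x) = inv' k (\<pi> x)" if "x \<in> X" for x
  proof -
    have "inv' g x \<in> X" using permutes_in_image[OF permutes_inv[OF gp]] that by simp
    then have "\<pi> x = k (\<pi> (inv' g x))" using g(2) permutes_inverses(1)[OF gp] by metis
    then show ?thesis using permutes_inverses(2)[OF k] by simp
  qed
  then show "inv' k \<in> pushforward \<pi> X G"
    using permutes_inv[OF k] subG(4)[OF g(1)] unfolding pushforward_def by blast
  fix l assume "l \<in> pushforward \<pi> X G"
  then obtain h where l: "l permutes \<pi> ` X" and h: "h \<in> G" "\<And>x. x \<in> X \<Longrightarrow> \<pi> (h x) = l (\<pi> x)"
    by (auto simp: pushforward_def)
  have "\<pi> ((g \<circ> h) x) = (k \<circ> l) (\<pi> x)" if "x \<in> X" for x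
    using g(2)[of "h x"] h(2)[OF that] permutes_in_image[OF subG(1)[OF h(1)]] that by simp
  then show "k \<circ> l \<in> pushforward \<pi> X G"
    using permutes_compose[OF l k] subG(3)[OF g(1) h(1)] unfolding pushforward_def by blast
qed

lemma transitive_group_pullback:
  assumes fib: "equal_fibres \<pi> X n" and K: "transitive_group (\<pi> ` X) K"
  shows "transitive_group X (pullback \<pi> X K)"
  unfolding transitive_group_def transitive_on_def
proof (intro conjI ballI)
  fix x y assume xy: "x \<in> X" "y \<in> X"
  obtain k where k: "k \<in> K" "k (\<pi> x) = \<pi> y"
    using transitive_groupD(4)[OF K imageI[OF xy(1)] imageI[OF xy(2)]] by blast
  note kp = subgroup_sym_onD(1)[OF transitive_groupD(3)[OF K] k(1)]
  obtain p where "p permutes X" "\<And>x. x \<in> X \<Longrightarrow> \<pi> (p x) = k (\<pi> x)" "p x = y"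
    using permutes_lift[OF fib kp _ xy(1) _ xy(2) k(2)[symmetric], of "{}"] by blast
  then show "\<exists>g\<in>pullback \<pi> X K. g x = y" using k(1) unfolding pullback_def by blast
qed (use fib transitive_groupD(2)[OF K] subgroup_pullback[OF transitive_groupD(3)[OF K]]
      in \<open>auto simp: equal_fibres_def\<close>)

lemma transitive_group_pushforward:
  assumes H: "transitive_group X H" and HK: "H \<subseteq> pullback \<pi> X {k. k permutes \<pi> ` X}"
  shows "transitive_group (\<pi> ` X) (pushforward \<pi> X H)"
  unfolding transitive_group_def transitive_on_def
proof (intro conjI ballI)
  fix y z assume "y \<in> \<pi> ` X" "z \<in> \<pi> ` X"
  then obtain a b where ab: "a \<in> X" "b \<in> X" "y = \<pi> a" "z = \<pi> b" by blast
  obtain h where h: "h \<in> H" "h a = b" using transitive_groupD(4)[OF H ab(1,2)] by blast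
  then obtain k where "k permutes \<pi> ` X" "\<forall>x\<in>X. \<pi> (h x) = k (\<pi> x)"
    using HK by (auto simp: pullback_def)
  then show "\<exists>k\<in>pushforward \<pi> X H. k y = z"
    using h ab unfolding pushforward_def by (intro bexI[of _ k]) auto
qed (use transitive_groupD(1,2)[OF H] subgroup_pushforward[OF transitive_groupD(3)[OF H]] in auto)

lemma pushforward_subset:
  assumes K: "subgroup K (sym_on (\<pi> ` X))" and HK: "H \<subseteq> pullback \<pi> X K"
  shows "pushforward \<pi> X H \<subseteq> K"
proof
  fix k assume "k \<in> pushforward \<pi> X H"
  then obtain h where k: "k permutes \<pi> ` X" and h: "h \<in> H" "\<And>x. x \<in> X \<Longrightarrow> \<pi> (h x) = k (\<pi> x)"
    by (auto simp: pushforward_def)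
  obtain l where l: "l \<in> K" "\<And>x. x \<in> X \<Longrightarrow> \<pi> (h x) = l (\<pi> x)"
    using HK h(1) by (auto simp: pullback_def)
  have "k = l"
    using h(2) l(2) by (intro permutes_eqI[OF k subgroup_sym_onD(1)[OF K l(1)]]) force
  then show "k \<in> K" using l by simp
qed

section \<open>Pullbacks of nine-eighth-closed groups\<close>

text \<open>The image of \<open>W\<close> under \<open>\<pi>\<close> satisfies the condition for a stabiliser in \<open>K\<close>, hence is
  trivial; as \<open>W\<close> is transitive on some block, \<open>\<pi>\<close> is constant on that block.\<close>

lemma constant_on_blocks:
  assumes K: "nine_eighth_closed (\<pi> ` X) K"
    and H: "transitive_group X H" "H \<subseteq> pullback \<pi> X K" and nbs: "normal_block_system X H \<B>"
    and B: "B \<in> \<B>" and W: "wstab_cond X H \<B> B W" "W \<noteq> {id}"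
    and B': "B' \<in> \<B>" "x \<in> B'" "y \<in> B'"
  shows "\<pi> x = \<pi> y"
proof -
  have trK: "transitive_group (\<pi> ` X) K" using K by (simp add: nine_eighth_closed_iff)
  note subK = transitive_groupD(3)[OF trK]
  note subH = transitive_groupD(3)[OF H(1)]
  note HD = subgroup_sym_onD[OF subH]
  note nb = normal_block_systemD[OF H(1) nbs]
  note WD = wstab_condD[OF subH W(1)]
  let ?push = "pushforward \<pi> X"
  \<comment> \<open>The images of the blocks are shown to be a normal block system of the
    pushforward of \<open>H\<close>, for which the pushforward of \<open>W\<close> satisfies the
    stabiliser condition at the image of \<open>B\<close>.\<close>
  define \<C> where "\<C> = (`) \<pi> ` \<B>"
  have HS: "H \<subseteq> pullback \<pi> X {k. k permutes \<pi> ` X}"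
    using H(2) pullback_mono[of K "{k. k permutes \<pi> ` X}" \<pi> X] subgroup_sym_onD(1)[OF subK] by blast
  have over: "\<exists>k\<in>?push {h}. \<forall>x\<in>X. \<pi> (h x) = k (\<pi> x)" if "h \<in> H" for h
    using that HS by (auto simp: pullback_def pushforward_def)
  have fixH: "fix_group H \<B> \<subseteq> H" by (auto simp: fix_group_def)
  have trP: "transitive_group (\<pi> ` X) (?push H)" by (rule transitive_group_pushforward[OF H(1) HS])
  have BX: "A \<subseteq> X" if "A \<in> \<B>" for A using partition_on_subset[OF nb(2) that] by simp
  have img: "k ` \<pi> ` A = \<pi> ` h ` A" if "\<forall>x\<in>X. \<pi> (h x) = k (\<pi> x)" "A \<in> \<B>" for h k A
    using that(1) BX[OF that(2)] by (force simp: image_image)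
  have fixpush: "?push (fix_group H \<B>) \<subseteq> fix_group (?push H) \<C>"
  proof
    fix k assume "k \<in> ?push (fix_group H \<B>)"
    then obtain h where h: "h \<in> fix_group H \<B>" "k permutes \<pi> ` X" "\<forall>x\<in>X. \<pi> (h x) = k (\<pi> x)"
      by (auto simp: pushforward_def)
    then have "h \<in> H" "\<And>A. A \<in> \<B> \<Longrightarrow> h ` A = A" by (simp_all add: fix_group_def)
    then have "k \<in> ?push H" "\<And>A. A \<in> \<B> \<Longrightarrow> k ` \<pi> ` A = \<pi> ` A"
      using h img[OF h(3)] by (auto simp: pushforward_def)
    then show "k \<in> fix_group (?push H) \<C>" by (simp add: fix_group_def \<C>_def)
  qed
  have lift: "\<exists>k\<in>fix_group (?push H) \<C>. k (\<pi> x) = \<pi> y" if xy: "A \<in> \<B>" "x \<in> A" "y \<in> A" for A x y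
  proof -
    obtain h where h: "h \<in> fix_group H \<B>" "h x = y" using nb(4)[OF xy] by blast
    then obtain k where k: "k \<in> ?push {h}" "\<forall>x\<in>X. \<pi> (h x) = k (\<pi> x)"
      using over fixH by (meson subsetD)
    then have "k \<in> ?push (fix_group H \<B>)" using h(1) by (auto simp: pushforward_def)
    moreover have "k (\<pi> x) = \<pi> y" using k(2) h(2) BX[OF xy(1)] xy(2) by force
    ultimately show ?thesis using fixpush by blast
  qed
  have inv\<C>: "k ` C \<in> \<C>" if "k \<in> ?push H" "C \<in> \<C>" for k C
  proof -
    obtain h where h: "h \<in> H" "\<forall>x\<in>X. \<pi> (h x) = k (\<pi> x)"
      using \<open>k \<in> ?push H\<close> by (auto simp: pushforward_def)
    obtain A where A: "A \<in> \<B>" "C = \<pi> ` A" using \<open>C \<in> \<C>\<close> by (auto simp: \<C>_def)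
    show ?thesis unfolding A(2) img[OF h(2) A(1)] \<C>_def using nb(3)[OF h(1) A(1)] by blast
  qed
  \<comment> \<open>If two image sets share a point, the kernel of the pushforward is transitive on
    the first and preserves the second, so the first lies in the second. By symmetry, overlapping
    image sets are equal.\<close>
  have sub: "\<pi> ` A \<subseteq> \<pi> ` A'" if A: "A \<in> \<B>" "A' \<in> \<B>" "a \<in> A" "a' \<in> A'" "\<pi> a = \<pi> a'" for A A' a a'
  proof
    fix z assume "z \<in> \<pi> ` A"
    then obtain b where b: "b \<in> A" "z = \<pi> b" by blast
    obtain k where k: "k \<in> fix_group (?push H) \<C>" "k (\<pi> a) = \<pi> b" using lift[OF A(1,3) b(1)] by blast
    have "k (\<pi> a') \<in> k ` \<pi> ` A'" using A(4) by blast
    also have "k ` \<pi> ` A' = \<pi> ` A'" using k(1) A(2) by (simp add: fix_group_def \<C>_def)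
    finally show "z \<in> \<pi> ` A'" using k(2) A(5) b(2) by simp
  qed
  have "partition_on (\<pi> ` X) \<C>"
  proof (rule partition_onI)
    show "\<Union>\<C> = \<pi> ` X" using partition_onD1[OF nb(2)] by (auto simp: \<C>_def)
    show "{} \<notin> \<C>" using partition_on_subset(2)[OF nb(2)] by (auto simp: \<C>_def)
    fix C D assume CD: "C \<in> \<C>" "D \<in> \<C>" "C \<noteq> D"
    obtain A A' where A: "A \<in> \<B>" "A' \<in> \<B>" "C = \<pi> ` A" "D = \<pi> ` A'" using CD by (auto simp: \<C>_def)
    show "disjnt C D"
    proof (rule ccontr)
      assume "\<not> disjnt C D"
      then obtain a a' where "a \<in> A" "a' \<in> A'" "\<pi> a = \<pi> a'" by (auto simp: A disjnt_def)
      then show False using sub[of A A' a a'] sub[of A' A a' a] A CD(3) by auto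
    qed
  qed
  then have nbs\<C>: "normal_block_system (\<pi> ` X) (?push H) \<C>"
    unfolding normal_block_system_iff[OF trP] using inv\<C> lift by (auto simp: \<C>_def)
  have condW: "wstab_cond (\<pi> ` X) (?push H) \<C> (\<pi> ` B) (?push W)"
    unfolding wstab_cond_iff[OF transitive_groupD(3)[OF trP]]
  proof (intro conjI)
    show "subgroup (?push W) (sym_on (\<pi> ` X))" by (rule subgroup_pushforward[OF WD(1)])
    show "?push W \<subseteq> fix_group (?push H) \<C>" using fixpush WD(2) by (auto simp: pushforward_def)
    have triv: "\<forall>w\<in>?push W. \<forall>z\<in>\<pi> ` A. w z = z" if A: "A \<in> \<B>" "\<forall>w\<in>W. \<forall>x\<in>A. w x = x" for A
      using A(2) BX[OF A(1)] by (force simp: pushforward_def)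
    then show "\<forall>w\<in>?push W. \<forall>z\<in>\<pi> ` B. w z = z" using B WD(3) by blast
    show "\<forall>C\<in>\<C>. (\<forall>y\<in>C. \<forall>z\<in>C. \<exists>w\<in>?push W. w y = z) \<or> (\<forall>w\<in>?push W. \<forall>z\<in>C. w z = z)"
    proof
      fix C assume "C \<in> \<C>"
      then obtain A where A: "A \<in> \<B>" "C = \<pi> ` A" by (auto simp: \<C>_def)
      consider "\<forall>x\<in>A. \<forall>y\<in>A. \<exists>w\<in>W. w x = y" | "\<forall>w\<in>W. \<forall>x\<in>A. w x = x" using WD(4)[OF A(1)] by blast
      then show "(\<forall>y\<in>C. \<forall>z\<in>C. \<exists>w\<in>?push W. w y = z) \<or> (\<forall>w\<in>?push W. \<forall>z\<in>C. w z = z)"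
      proof cases
        case 1
        have "\<exists>w\<in>?push W. w (\<pi> a) = \<pi> b" if ab: "a \<in> A" "b \<in> A" for a b
        proof -
          obtain w where w: "w \<in> W" "w a = b" using 1 ab by blast
          then obtain k where k: "k \<in> ?push {w}" "\<forall>x\<in>X. \<pi> (w x) = k (\<pi> x)"
            using over fixH WD(2) by (meson subsetD)
          have "k \<in> ?push W" using k w by (auto simp: pushforward_def)
          moreover have "k (\<pi> a) = \<pi> b" using k(2) w(2) BX[OF A(1)] ab by force
          ultimately show ?thesis by blast
        qed
        then show ?thesis by (auto simp: A(2))
      next
        case 2
        then show ?thesis using triv[OF A(1)] A(2) by blast
      qed
    qed
  qed
  have "\<pi> ` B \<in> \<C>" using B by (simp add: \<C>_def)
  then have pushW: "?push W = {id}"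
    using K trP pushforward_subset[OF subK H(2)] nbs\<C> condW
    unfolding nine_eighth_closed_iff by metis
  obtain w where w: "w \<in> W" "w \<noteq> id" using W(2) WD(1) subgroup_sym_onD(2) by blast
  then obtain a where a: "w a \<noteq> a" by (auto simp: fun_eq_iff)
  then have aX: "a \<in> X" using permutes_not_in[OF subgroup_sym_onD(1)[OF WD(1) w(1)]] by blast
  then obtain A where A: "A \<in> \<B>" "a \<in> A" using partition_on_exists[OF nb(2)] by blast
  have trA: "\<forall>x\<in>A. \<forall>y\<in>A. \<exists>w\<in>W. w x = y" using WD(4)[OF A(1)] w(1) A(2) a by blast
  have constA: "\<pi> b = \<pi> a" if b: "b \<in> A" for b
  proof -
    obtain w where w: "w \<in> W" "w a = b" using trA A(2) b by blast
    then obtain k where k: "k \<in> ?push {w}" "\<forall>x\<in>X. \<pi> (w x) = k (\<pi> x)"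
      using over fixH WD(2) by (meson subsetD)
    then have "k \<in> ?push W" using w by (auto simp: pushforward_def)
    then have "k = id" using pushW by blast
    then show ?thesis using k(2) aX w(2) by auto
  qed
  have xX: "x \<in> X" using BX B' by blast
  \<comment> \<open>Constancy on \<open>A\<close> passes to \<open>B'\<close>: an element of
    \<open>H\<close> carries \<open>A\<close> to \<open>B'\<close>, and it respects the fibres of
    \<open>\<pi>\<close>.\<close>
  obtain h where h: "h \<in> H" "h a = x" using transitive_groupD(4)[OF H(1) aX xX] by blast
  have "h ` A = B'" using partition_on_eqI[OF nb(2) nb(3)[OF h(1) A(1)] B'(1) _ B'(2)] h(2) A(2) by blast
  then obtain b where b: "b \<in> A" "y = h b" using B'(3) by blast
  obtain k where "\<forall>x\<in>X. \<pi> (h x) = k (\<pi> x)" using over[OF h(1)] by blast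
  then show ?thesis using constA[OF b(1)] b BX[OF A(1)] aX h(2) by force
qed

section \<open>Kernels, pointwise stabilisers and passage to larger groups\<close>

lemma fix_group_mono: "G \<subseteq> G' \<Longrightarrow> fix_group G \<B> \<subseteq> fix_group G' \<B>"
  by (auto simp: fix_group_def)

lemma subgroup_pointwise_stabiliser:
  assumes "subgroup G (sym_on X)"
  shows "subgroup {g \<in> G. \<forall>x\<in>A. g x = x} (sym_on X)"
proof (rule subgroup_sym_onI)
  note sub = subgroup_sym_onD[OF assms]
  let ?S = "{g \<in> G. \<forall>x\<in>A. g x = x}"
  show "g permutes X" if "g \<in> ?S" for g using that sub(1) by simp
  show "id \<in> ?S" using sub(2) by simp
  show "g \<circ> h \<in> ?S" if "g \<in> ?S" "h \<in> ?S" for g h using that sub(3)[of g h] by simp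
  show "inv' g \<in> ?S" if "g \<in> ?S" for g
    using that sub(4)[of g] permutes_inv_eq[OF sub(1), of g] by simp
qed

lemma permutes_block_in_fix_group:
  assumes part: "partition_on X \<B>" and B: "B \<in> \<B>" and p: "p permutes B" "p \<in> G"
  shows "p \<in> fix_group G \<B>"
proof -
  have "p ` A = A" if A: "A \<in> \<B>" for A
  proof (cases "A = B")
    case True
    then show ?thesis using permutes_image[OF p(1)] by simp
  next
    case False
    then have "p x = x" if "x \<in> A" for x
      using that partition_on_eqI[OF part A B] permutes_not_in[OF p(1)] by blast
    then show ?thesis by simp
  qed
  then show ?thesis using p(2) by (simp add: fix_group_def)
qed

text \<open>For points \<open>x\<close> and \<open>y\<close> of a block other than \<open>B\<close>,
  their transposition preserves all blocks and fixes \<open>B\<close> pointwise. So the whole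
  pointwise stabiliser of \<open>B\<close> in the kernel is transitive on every other block.\<close>

lemma wstab_cond_pointwise_stabiliser:
  assumes G: "subgroup G (sym_on X)" and part: "partition_on X \<B>" and B: "B \<in> \<B>"
    and tr: "\<And>A x y. A \<in> \<B> \<Longrightarrow> x \<in> A \<Longrightarrow> y \<in> A \<Longrightarrow> transpose x y \<in> G"
  shows "wstab_cond X G \<B> B {g \<in> fix_group G \<B>. \<forall>x\<in>B. g x = x}" (is "wstab_cond X G \<B> B ?W")
  unfolding wstab_cond_iff[OF G]
proof (intro conjI ballI)
  show "subgroup ?W (sym_on X)" by (rule subgroup_pointwise_stabiliser[OF subgroup_fix_group[OF G]])
  fix A assume A: "A \<in> \<B>"
  show "(\<forall>x\<in>A. \<forall>y\<in>A. \<exists>w\<in>?W. w x = y) \<or> (\<forall>w\<in>?W. \<forall>x\<in>A. w x = x)"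
  proof (cases "A = B")
    case False
    have "transpose x y \<in> ?W" if xy: "x \<in> A" "y \<in> A" for x y
    proof -
      have "z \<notin> A" if "z \<in> B" for z using partition_on_eqI[OF part A B] that False by blast
      then have "transpose x y z = z" if "z \<in> B" for z
        using that xy by (intro transpose_apply_other) blast+
      then show ?thesis
        using permutes_block_in_fix_group[OF part A permutes_swap_id[OF xy] tr[OF A xy]] by simp
    qed
    then have "\<exists>w\<in>?W. w x = y" if "x \<in> A" "y \<in> A" for x y
      using that by (intro bexI[of _ "transpose x y"]) simp_all
    then show ?thesis by blast
  qed simp
qed auto

text \<open>Carries a stabiliser found for \<open>H\<close> over to a larger group with the same
  blocks, since the kernel only grows.\<close>

lemma wstab_cond_mono:
  assumes H: "subgroup H (sym_on X)" and G: "subgroup G (sym_on X)" and HG: "H \<subseteq> G"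
    and W: "wstab_cond X H \<B> B W"
  shows "wstab_cond X G \<B> B W"
  using W fix_group_mono[OF HG, of \<B>] unfolding wstab_cond_iff[OF H] wstab_cond_iff[OF G]
  by (meson order_trans)

lemma normal_block_system_mono:
  assumes H: "transitive_group X H" and G: "transitive_group X G" and HG: "H \<subseteq> G"
    and nbs: "normal_block_system X H \<B>" and bs: "block_system X G \<B>"
  shows "normal_block_system X G \<B>"
  unfolding normal_block_system_iff[OF G]
proof (intro conjI ballI)
  show "\<exists>g\<in>fix_group G \<B>. g x = y" if "B \<in> \<B>" "x \<in> B" "y \<in> B" for B x y
    using normal_block_systemD(4)[OF H nbs that] fix_group_mono[OF HG, of \<B>] by blast
qed (use block_systemD[OF G bs] in auto)

lemma fixer_block_system_neq_singletonD:
  assumes "transitive_group X H" "normal_block_system X H \<B>" "fixer_block_system X H \<B> \<noteq> {X}"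
  obtains B W where "B \<in> \<B>" "wstab_cond X H \<B> B W" "W \<noteq> {id}"
  using fixer_block_system_eq_singleton_iff[OF transitive_groupD(3)[OF assms(1)]
      normal_block_systemD(2)[OF assms(1,2)] transitive_groupD(2)[OF assms(1)]] assms(3)
  by blast

lemma fixer_block_system_neq_singletonI:
  assumes "transitive_group X H" "normal_block_system X H \<B>"
    "B \<in> \<B>" "wstab_cond X H \<B> B W" "W \<noteq> {id}"
  shows "fixer_block_system X H \<B> \<noteq> {X}"
  using fixer_block_system_eq_singleton_iff[OF transitive_groupD(3)[OF assms(1)]
      normal_block_systemD(2)[OF assms(1,2)] transitive_groupD(2)[OF assms(1)]] assms(3-5)
  by blast

text \<open>A nontrivial element of \<open>W\<close> moves some point but preserves the block of
  that point, so a nontrivial stabiliser excludes the partition into singletons.\<close>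

lemma wstab_cond_moves:
  assumes H: "transitive_group X H" and nbs: "normal_block_system X H \<B>"
    and W: "wstab_cond X H \<B> B W" "W \<noteq> {id}"
  obtains A x y where "A \<in> \<B>" "x \<in> A" "y \<in> A" "x \<noteq> y"
proof -
  note HS = transitive_groupD(3)[OF H]
  note WS = wstab_condD(1,2)[OF HS W(1)]
  obtain w where w: "w \<in> W" "w \<noteq> id" using W(2) subgroup_sym_onD(2)[OF WS(1)] by blast
  obtain a where a: "w a \<noteq> a" using w(2) by (auto simp: fun_eq_iff)
  then have "a \<in> X" using permutes_not_in[OF subgroup_sym_onD(1)[OF WS(1) w(1)]] by blast
  then obtain A where A: "A \<in> \<B>" "a \<in> A"
    using partition_on_exists[OF normal_block_systemD(2)[OF H nbs]] by blast
  have "w ` A = A" using WS(2) w(1) A(1) by (auto simp: fix_group_def)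
  then have "w a \<in> A" using A(2) by blast
  then show ?thesis using that A a by metis
qed

text \<open>When a fixer block system differs from \<open>{X}\<close>, the blocks lie in fibres of
  \<open>\<pi>\<close> by \<open>constant_on_blocks\<close>. Then every permutation moving points
  only within blocks belongs to the pullback, which gives 5/2-closure and the full symmetric groups
  on blocks. It also makes the stabilisers of different blocks different.\<close>

lemma three_half_closed_pullback:
  assumes K: "nine_eighth_closed (\<pi> ` X) K" and fib: "equal_fibres \<pi> X n"
  shows "three_half_closed X (pullback \<pi> X K)"
proof -
  define G where "G = pullback \<pi> X K"
  have trK: "transitive_group (\<pi> ` X) K" using K by (simp add: nine_eighth_closed_iff)
  have trG: "transitive_group X G" unfolding G_def by (rule transitive_group_pullback[OF fib trK])
  note GS = transitive_groupD(3)[OF trG]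
  have vert: "p \<in> G" if "p permutes X" "\<And>x. x \<in> X \<Longrightarrow> \<pi> (p x) = \<pi> x" for p
    using that subgroup_sym_onD(2)[OF transitive_groupD(3)[OF trK]]
    unfolding G_def pullback_def by (auto intro!: bexI[of _ id])
  have const: "\<pi> x = \<pi> y"
    if H: "transitive_group X H" "H \<subseteq> G" "normal_block_system X H \<B>"
        "fixer_block_system X H \<B> \<noteq> {X}" and B: "B \<in> \<B>" "x \<in> B" "y \<in> B" for H \<B> B x y
  proof -
    obtain C W where "C \<in> \<B>" "wstab_cond X H \<B> C W" "W \<noteq> {id}"
      using fixer_block_system_neq_singletonD[OF H(1,3,4)] .
    then show ?thesis by (rule constant_on_blocks[OF K H(1) H(2)[unfolded G_def] H(3) _ _ _ B])
  qed
  have five: "restrict_id g E \<in> G"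
    if H: "transitive_group X H" "H \<subseteq> G" "normal_block_system X H \<B>"
      and E: "E \<in> fixer_block_system X H \<B>" and g: "g \<in> G" "\<And>B. B \<in> \<B> \<Longrightarrow> B \<subseteq> E \<Longrightarrow> g ` B = B"
    for H \<B> E g
  proof (cases "fixer_block_system X H \<B> = {X}")
    case True
    then have "restrict_id g E = g"
      using E permutes_not_in[OF subgroup_sym_onD(1)[OF GS g(1)]] by (auto simp: restrict_id_def)
    then show ?thesis using g(1) by simp
  next
    case False
    obtain S where S: "S \<subseteq> \<B>" "E = \<Union>S" using fixer_block_system_Union[OF E] .
    have gS: "g ` B = B" if "B \<in> S" for B using g(2)[of B] S that by blast
    have "g ` E = E" unfolding S(2) image_Union using gS by simp
    then have "bij_betw g E E"
      using permutes_inj_on[OF subgroup_sym_onD(1)[OF GS g(1)]] by (simp add: bij_betw_def)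
    moreover have "E \<subseteq> X"
      using S partition_on_subset(1)[OF normal_block_systemD(2)[OF H(1,3)]] by blast
    ultimately have "restrict_id g E permutes X"
      by (rule permutes_subset[OF permutes_restrict_id])
    \<comment> \<open>\<open>E\<close> is a union of blocks that \<open>g\<close> preserves, and
      blocks lie in fibres, so the restriction moves points only within fibres.\<close>
    moreover have "\<pi> (restrict_id g E x) = \<pi> x" for x
    proof (cases "x \<in> E")
      case True
      then obtain B where "B \<in> S" "x \<in> B" using S(2) by blast
      moreover from this have "g x \<in> B" using gS by blast
      ultimately show ?thesis using const[OF H False, of B "g x" x] S(1) True by auto
    qed simp
    ultimately show ?thesis by (rule vert)
  qed
  have three: "fixer_block_system X (largest_with_blocks X G \<B>) \<B> \<in> {\<B>, {X}} \<and>
    (fixer_block_system X H \<B> = \<B> \<and> \<B> \<noteq> {X} \<longrightarrow>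
      (\<forall>B\<in>\<B>. induced (fix_group (largest_with_blocks X G \<B>) \<B>) B = carrier (sym_on B)))"
    if H: "transitive_group X H" "H \<subseteq> G" "normal_block_system X H \<B>" for H \<B>
  proof -
    define L where "L = {g \<in> G. \<forall>B\<in>\<B>. g ` B \<in> \<B>}"
    note nb = normal_block_systemD[OF H(1,3)]
    have L: "largest_with_blocks X G \<B> = L" "transitive_group X L" "block_system X L \<B>"
      unfolding L_def by (rule largest_with_blocks_eq[OF GS H(1,2) nb(1)])+
    have LG: "L \<subseteq> G" by (auto simp: L_def)
    have "H \<subseteq> L" using H(2) nb(3) by (auto simp: L_def)
    then have nbsL: "normal_block_system X L \<B>"
      using normal_block_system_mono[OF H(1) L(2) _ H(3) L(3)] by simp
    have perm: "p \<in> fix_group L \<B>"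
      if c: "\<And>B x y. B \<in> \<B> \<Longrightarrow> x \<in> B \<Longrightarrow> y \<in> B \<Longrightarrow> \<pi> x = \<pi> y" and B: "B \<in> \<B>" and p: "p permutes B" for B p
    proof -
      have "\<pi> (p x) = \<pi> x" for x
        using c[OF B, of "p x" x] permutes_in_image[OF p, of x] permutes_not_in[OF p, of x]
        by (cases "x \<in> B") auto
      then have "p \<in> G"
        using permutes_subset[OF p partition_on_subset(1)[OF nb(2) B]] by (intro vert)
      then have "p \<in> fix_group G \<B>" by (rule permutes_block_in_fix_group[OF nb(2) B p])
      then show ?thesis by (simp add: fix_group_def L_def)
    qed
    have "fixer_block_system X L \<B> = \<B>" if ne: "fixer_block_system X L \<B> \<noteq> {X}"
    proof (rule fixer_block_system_eq_self[OF nb(2)])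
      \<comment> \<open>Here \<open>const\<close> is applied to \<open>L\<close>, which is itself a
        transitive subgroup of \<open>G\<close> with normal block system
        \<open>\<B>\<close>.\<close>
      have c: "\<And>B x y. B \<in> \<B> \<Longrightarrow> x \<in> B \<Longrightarrow> y \<in> B \<Longrightarrow> \<pi> x = \<pi> y"
        using const[OF L(2) LG nbsL ne] .
      obtain C W where "C \<in> \<B>" "wstab_cond X L \<B> C W" "W \<noteq> {id}"
        using fixer_block_system_neq_singletonD[OF L(2) nbsL ne] .
      then obtain A a a' where A: "A \<in> \<B>" "a \<in> A" "a' \<in> A" "a \<noteq> a'"
        using wstab_cond_moves[OF L(2) nbsL] by metis
      show "inj_on (wstab X L \<B>) \<B>"
      proof (rule inj_onI, rule ccontr)
        fix B B' assume BB: "B \<in> \<B>" "B' \<in> \<B>" "wstab X L \<B> B = wstab X L \<B> B'" "B \<noteq> B'"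
        obtain b where b: "b \<in> B'" "b \<in> X" using partition_on_subset[OF nb(2) BB(2)] by blast
        have aX: "a \<in> X" using partition_on_subset[OF nb(2) A(1)] A(2) by blast
        \<comment> \<open>Carrying the pair \<open>a\<close>, \<open>a'\<close> into
          \<open>B'\<close> gives two distinct points of \<open>B'\<close>. Their transposition lies
          in the stabiliser of \<open>B\<close> but moves \<open>b\<close>, so it is not in the
          stabiliser of \<open>B'\<close>.\<close>
        obtain h where h: "h \<in> L" "h a = b" using transitive_groupD(4)[OF L(2) aX b(2)] by blast
        have "h ` A = B'"
          using partition_on_eqI[OF nb(2) block_systemD(2)[OF L(2,3) h(1) A(1)] BB(2) _ b(1)] h(2) A(2)
          by blast
        then have h': "h a' \<in> B'" using A(3) by blast
        have hinj: "h a' \<noteq> b"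
          using h(2) A(4) permutes_inj[OF subgroup_sym_onD(1)[OF transitive_groupD(3)[OF L(2)] h(1)]]
          by (metis injD)
        let ?t = "transpose b (h a')"
        have bn: "x \<notin> B'" if "x \<in> B" for x using partition_on_eqI[OF nb(2) BB(1,2)] BB(4) that by blast
        have "?t x = x" if "x \<in> B" for x
          using bn[OF that] b(1) h' by (intro transpose_apply_other) blast+
        moreover have "?t \<in> fix_group L \<B>" by (rule perm[OF c BB(2) permutes_swap_id[OF b(1) h']])
        moreover have "wstab_cond X L \<B> B {g \<in> fix_group L \<B>. \<forall>x\<in>B. g x = x}"
        proof (rule wstab_cond_pointwise_stabiliser[OF transitive_groupD(3)[OF L(2)] nb(2) BB(1)])
          show "transpose x y \<in> L" if "A \<in> \<B>" "x \<in> A" "y \<in> A" for A x y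
            using perm[OF c that(1) permutes_swap_id[OF that(2,3)]] by (simp add: fix_group_def)
        qed
        ultimately have "?t \<in> wstab X L \<B> B'"
          using wstab_greatest(2)[OF transitive_groupD(3)[OF L(2)]] unfolding BB(3)[symmetric] by blast
        then have "?t b = b"
          using wstab_condD(3)[OF transitive_groupD(3)[OF L(2)]
              wstab_greatest(1)[OF transitive_groupD(3)[OF L(2)]]] b(1) by blast
        then show False using hinj by simp
      qed
    qed
    moreover have "induced (fix_group L \<B>) B = carrier (sym_on B)"
      if ne: "fixer_block_system X H \<B> = \<B>" "\<B> \<noteq> {X}" and B: "B \<in> \<B>" for B
    proof
      have nX: "fixer_block_system X H \<B> \<noteq> {X}" using ne by simp
      have c: "\<And>B x y. B \<in> \<B> \<Longrightarrow> x \<in> B \<Longrightarrow> y \<in> B \<Longrightarrow> \<pi> x = \<pi> y"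
        using const[OF H nX] .
      show "carrier (sym_on B) \<subseteq> induced (fix_group L \<B>) B"
      proof
        fix p assume "p \<in> carrier (sym_on B)"
        then have p: "p permutes B" by simp
        then have "restrict_id p B = p" using permutes_not_in[OF p] by (auto simp: restrict_id_def)
        then show "p \<in> induced (fix_group L \<B>) B"
          using perm[OF c B p] unfolding induced_def by (intro CollectI exI[of _ p]) simp
      qed
      show "induced (fix_group L \<B>) B \<subseteq> carrier (sym_on B)"
      proof
        fix p assume "p \<in> induced (fix_group L \<B>) B"
        then obtain g where g: "g \<in> fix_group L \<B>" "p = restrict_id g B" by (auto simp: induced_def)
        then have "g \<in> L" "g ` B = B" using B by (auto simp: fix_group_def)
        then have "bij_betw g B B"
          using permutes_inj_on[OF subgroup_sym_onD(1)[OF transitive_groupD(3)[OF L(2)]]]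
          by (simp add: bij_betw_def)
        then show "p \<in> carrier (sym_on B)" using permutes_restrict_id g(2) by simp
      qed
    qed
    ultimately show ?thesis unfolding L(1) by blast
  qed
  have "five_half_closed X G"
    unfolding five_half_closed_def
  proof (intro conjI[OF trG] allI impI, elim conjE)
    show "restrict_id g E \<in> G"
      if "transitive_group X H" "H \<subseteq> G" "normal_block_system X H \<B>"
        "E \<in> fixer_block_system X H \<B>" "g \<in> G" "\<forall>B\<in>\<B>. B \<subseteq> E \<longrightarrow> g ` B = B" for H \<B> E g
      using that by (intro five[of H \<B>]) simp_all
  qed
  then show ?thesis
    unfolding three_half_closed_def G_def[symmetric] Let_def
    by (intro conjI[OF \<open>five_half_closed X G\<close>] allI impI three) simp_all
qed

section \<open>Pullbacks with several large fibres are not 9/8-closed\<close>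

lemma nine_eighth_closedD:
  assumes "nine_eighth_closed X G" "transitive_group X H" "H \<subseteq> G" "normal_block_system X H \<B>"
    "B \<in> \<B>" "wstab_cond X H \<B> B W"
  shows "W = {id}"
  using assms unfolding nine_eighth_closed_iff by metis

lemma two_le_cardE:
  assumes "2 \<le> card A"
  obtains x y where "x \<in> A" "y \<in> A" "x \<noteq> y"
proof -
  have "finite A" using assms card.infinite by fastforce
  then show ?thesis using card_le_Suc0_iff_eq[of A] assms that by force
qed

text \<open>Take the fibres of \<open>\<pi>\<close> as blocks. A transposition inside one fibre
  fixes another fibre pointwise, so the stabiliser of the latter is nontrivial. The overgroup
  \<open>G\<close> allows two applications: to the pullback itself, and to a symmetric group of
  composite degree.\<close>

lemma pullback_not_nine_eighth_closed:
  assumes K: "transitive_group (\<pi> ` X) K" and fib: "equal_fibres \<pi> X n" and n: "2 \<le> n"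
    and card: "2 \<le> card (\<pi> ` X)" and sub: "pullback \<pi> X K \<subseteq> G"
  shows "\<not> nine_eighth_closed X G"
proof
  assume G: "nine_eighth_closed X G"
  let ?H = "pullback \<pi> X K"
  let ?F = "\<lambda>z. {x \<in> X. \<pi> x = z}"
  define \<B> where "\<B> = ?F ` \<pi> ` X"
  note KS = transitive_groupD(3)[OF K]
  have H: "transitive_group X ?H" by (rule transitive_group_pullback[OF fib K])
  note HS = transitive_groupD(3)[OF H]
  have part: "partition_on X \<B>"
    by (rule partition_onI) (auto simp: \<B>_def disjnt_def)
  have inv: "h ` B \<in> \<B>" if h: "h \<in> ?H" and B: "B \<in> \<B>" for h B
  proof -
    obtain k where k: "h permutes X" "k \<in> K" "\<And>x. x \<in> X \<Longrightarrow> \<pi> (h x) = k (\<pi> x)"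
      using h by (auto simp: pullback_def)
    obtain z where z: "z \<in> \<pi> ` X" "B = ?F z" using B by (auto simp: \<B>_def)
    note kp = subgroup_sym_onD(1)[OF KS k(2)]
    have "h ` ?F z = ?F (k z)"
    proof
      show "h ` ?F z \<subseteq> ?F (k z)" using k(3) permutes_in_image[OF k(1)] by auto
      show "?F (k z) \<subseteq> h ` ?F z"
      proof
        fix y assume y: "y \<in> ?F (k z)"
        define x where "x = inv' h y"
        have x: "h x = y" "x \<in> X"
          using y permutes_inverses(1)[OF k(1)] permutes_in_image[OF permutes_inv[OF k(1)]]
          by (auto simp: x_def)
        then have "k (\<pi> x) = k z" using k(3)[OF x(2)] y by simp
        then have "\<pi> x = z" using permutes_inj[OF kp] by (simp add: inj_eq)
        then show "y \<in> h ` ?F z" using x by blast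
      qed
    qed
    then show ?thesis using z permutes_in_image[OF kp] by (auto simp: \<B>_def)
  qed
  have tr: "transpose x y \<in> ?H" if A: "A \<in> \<B>" and xy: "x \<in> A" "y \<in> A" for A x y
  proof -
    have e: "x \<in> X" "y \<in> X" "\<pi> x = \<pi> y" using A xy by (auto simp: \<B>_def)
    then have "\<pi> (transpose x y z) = \<pi> z" for z by (simp add: transpose_def)
    then show ?thesis
      using permutes_swap_id[OF e(1,2)] subgroup_sym_onD(2)[OF KS]
      by (auto simp: pullback_def intro!: bexI[of _ id])
  qed
  have "normal_block_system X ?H \<B>"
    unfolding normal_block_system_iff[OF H]
  proof (intro conjI ballI part inv)
    show "\<exists>g\<in>fix_group ?H \<B>. g x = y" if A: "A \<in> \<B>" "x \<in> A" "y \<in> A" for A x y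
      using permutes_block_in_fix_group[OF part A(1) permutes_swap_id[OF A(2,3)] tr[OF A]]
      by (intro bexI[of _ "transpose x y"]) simp_all
  qed
  note nbs = this
  obtain z z' where z: "z \<in> \<pi> ` X" "z' \<in> \<pi> ` X" "z \<noteq> z'"
    using two_le_cardE[OF card] .
  have B: "?F z \<in> \<B>" "?F z' \<in> \<B>" using z by (auto simp: \<B>_def)
  have triv: "{g \<in> fix_group ?H \<B>. \<forall>x\<in>?F z. g x = x} = {id}"
    by (rule nine_eighth_closedD[OF G H sub nbs B(1) wstab_cond_pointwise_stabiliser[OF HS part B(1) tr]])
  have "card (?F z') \<ge> 2" using fib z(2) n by (auto simp: equal_fibres_def)
  then obtain a b where ab: "a \<in> ?F z'" "b \<in> ?F z'" "a \<noteq> b"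
    by (rule two_le_cardE)
  have "transpose a b x = x" if "x \<in> ?F z" for x
    using that ab z(3) by (auto simp: transpose_def)
  then have "transpose a b = id"
    using permutes_block_in_fix_group[OF part B(2) permutes_swap_id[OF ab(1,2)] tr[OF B(2) ab(1,2)]] triv
    by blast
  then show False using ab(3) by (simp add: transpose_eq_id_iff)
qed

section \<open>Recovering the wreath decomposition\<close>

text \<open>The stabiliser \<open>W\<close> stays nontrivial in \<open>K\<close>, the largest
  subgroup of \<open>G\<close> with blocks \<open>\<B>\<close>, so the fixer block system of
  \<open>K\<close> must be \<open>\<B>\<close>. The closure condition then says that the kernel of
  \<open>K\<close> induces \<open>p\<close> on \<open>B\<close>, and 5/2-closure with
  \<open>E = B\<close> cuts the inducing element down to \<open>p\<close>.\<close>

lemma permutes_block_in_three_half_closed: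
  assumes G: "three_half_closed X G" and H: "transitive_group X H" "H \<subseteq> G" "normal_block_system X H \<B>"
    and C: "C \<in> \<B>" and W: "wstab_cond X H \<B> C W" "W \<noteq> {id}"
    and B: "B \<in> \<B>" and p: "p permutes B"
  shows "p \<in> G"
proof -
  have five: "five_half_closed X G" using G by (simp add: three_half_closed_def)
  then have trG: "transitive_group X G" by (simp add: five_half_closed_def)
  note nb = normal_block_systemD[OF H(1,3)]
  define K where "K = {g \<in> G. \<forall>B\<in>\<B>. g ` B \<in> \<B>}"
  have K: "largest_with_blocks X G \<B> = K" "transitive_group X K" "block_system X K \<B>"
    unfolding K_def by (rule largest_with_blocks_eq[OF transitive_groupD(3)[OF trG] H(1,2) nb(1)])+
  have KG: "K \<subseteq> G" by (auto simp: K_def)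
  have HK: "H \<subseteq> K" using H(2) nb(3) by (auto simp: K_def)
  have nbsK: "normal_block_system X K \<B>" by (rule normal_block_system_mono[OF H(1) K(2) HK H(3) K(3)])
  have WK: "wstab_cond X K \<B> C W"
    by (rule wstab_cond_mono[OF transitive_groupD(3)[OF H(1)] transitive_groupD(3)[OF K(2)] HK W(1)])
  have ne: "fixer_block_system X K \<B> \<noteq> {X}"
    by (rule fixer_block_system_neq_singletonI[OF K(2) nbsK C WK W(2)])
  \<comment> \<open>The closure condition is used with \<open>K\<close> in the place of
    \<open>H\<close>; the largest subgroup it refers to is again \<open>K\<close>.\<close>
  have three: "fixer_block_system X K \<B> \<in> {\<B>, {X}} \<and> (fixer_block_system X K \<B> = \<B> \<and> \<B> \<noteq> {X} \<longrightarrow>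
      (\<forall>B\<in>\<B>. induced (fix_group K \<B>) B = carrier (sym_on B)))"
    using G K(2) KG nbsK unfolding three_half_closed_def Let_def K(1)[symmetric] by simp
  then have eq: "fixer_block_system X K \<B> = \<B>" using ne by simp
  then have "induced (fix_group K \<B>) B = carrier (sym_on B)" using three ne B by simp
  then have "p \<in> induced (fix_group K \<B>) B" using p by simp
  then obtain g where g: "g \<in> fix_group K \<B>" "p = restrict_id g B" by (auto simp: induced_def)
  have "g \<in> G" "\<forall>B'\<in>\<B>. B' \<subseteq> B \<longrightarrow> g ` B' = B'" using g(1) KG by (auto simp: fix_group_def)
  then show "p \<in> G"
    unfolding g(2) using five K(2) KG nbsK B eq unfolding five_half_closed_def by metis
qed

text \<open>Transpositions inside fibres generate all permutations that preserve each fibre; the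
  proof is by induction on the number of moved points.\<close>

lemma fibrewise_permutation_in_group:
  assumes G: "subgroup G (sym_on X)" and fin: "finite X"
    and tr: "\<And>x y. x \<in> X \<Longrightarrow> y \<in> X \<Longrightarrow> \<pi> x = \<pi> y \<Longrightarrow> transpose x y \<in> G"
    and p: "p permutes X" "\<And>x. x \<in> X \<Longrightarrow> \<pi> (p x) = \<pi> x"
  shows "p \<in> G"
  using p
proof (induction "card {x \<in> X. p x \<noteq> x}" arbitrary: p rule: less_induct)
  case less
  show ?case
  proof (cases "\<exists>x\<in>X. p x \<noteq> x")
    case False
    then have "p = id" using permutes_not_in[OF less.prems(1)] by (metis eq_id_iff)
    then show ?thesis using subgroup_sym_onD(2)[OF G] by simp
  next
    case True
    then obtain a where a: "a \<in> X" "p a \<noteq> a" by blast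
    have pa: "p a \<in> X" "\<pi> (p a) = \<pi> a" using permutes_in_image[OF less.prems(1)] a less.prems(2) by auto
    let ?t = "transpose a (p a)"
    \<comment> \<open>\<open>q\<close> fixes \<open>a\<close> and every fixed point of
      \<open>p\<close>, so it moves fewer points.\<close>
    define q where "q = ?t \<circ> p"
    have t: "?t \<in> G" using tr[OF a(1) pa(1)] pa(2) by simp
    have qp: "q permutes X"
      unfolding q_def by (rule permutes_compose[OF less.prems(1) permutes_swap_id[OF a(1) pa(1)]])
    have q\<pi>: "\<pi> (q x) = \<pi> x" if "x \<in> X" for x
      using less.prems(2)[OF that] pa(2) by (auto simp: q_def transpose_def)
    have qfix: "q x = x" if "p x = x" for x
      using that a(2) permutes_inj[OF less.prems(1)] by (auto simp: q_def transpose_def inj_eq)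
    have "{x \<in> X. q x \<noteq> x} \<subseteq> {x \<in> X. p x \<noteq> x}" using qfix by auto
    moreover have "a \<notin> {x \<in> X. q x \<noteq> x}" "a \<in> {x \<in> X. p x \<noteq> x}" using a by (auto simp: q_def)
    ultimately have "{x \<in> X. q x \<noteq> x} \<subset> {x \<in> X. p x \<noteq> x}" by blast
    then have "card {x \<in> X. q x \<noteq> x} < card {x \<in> X. p x \<noteq> x}" using fin by (intro psubset_card_mono) simp
    then have "q \<in> G" using less.hyps qp q\<pi> by blast
    then have "?t \<circ> q \<in> G" by (rule subgroup_sym_onD(3)[OF G t])
    moreover have "?t \<circ> q = p" by (simp add: q_def fun_eq_iff)
    ultimately show ?thesis by simp
  qed
qed

text \<open>One direction of the equivalence makes the induced map independent of the chosen
  preimage, the other makes it injective; finiteness turns it into a permutation.\<close>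

lemma permutes_descend:
  assumes fin: "finite X" and g: "g permutes X"
    and inv: "\<And>x y. x \<in> X \<Longrightarrow> y \<in> X \<Longrightarrow> \<pi> (g x) = \<pi> (g y) \<longleftrightarrow> \<pi> x = \<pi> y"
  obtains k where "k permutes \<pi> ` X" "\<And>x. x \<in> X \<Longrightarrow> \<pi> (g x) = k (\<pi> x)"
proof -
  define k where "k z = (if z \<in> \<pi> ` X then \<pi> (g (inv_into X \<pi> z)) else z)" for z
  have k: "k (\<pi> x) = \<pi> (g x)" if "x \<in> X" for x
    using inv[OF inv_into_into[of "\<pi> x" \<pi> X] that] f_inv_into_f[of "\<pi> x" \<pi> X] that by (simp add: k_def)
  have "k permutes \<pi> ` X"
  proof (rule inj_imp_permutes)
    show "inj_on k (\<pi> ` X)" by (rule inj_onI) (use k inv in auto)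
    show "k z \<in> \<pi> ` X" if "z \<in> \<pi> ` X" for z using that k permutes_in_image[OF g] by auto
  qed (use fin in \<open>simp_all add: k_def\<close>)
  then show ?thesis using that k by metis
qed

text \<open>This is the lifting counterpart of \<open>constant_on_blocks\<close>: a nontrivial
  stabiliser downstairs produces a nontrivial one upstairs, for the preimages of the blocks.\<close>

lemma wstab_cond_pullback:
  assumes fib: "equal_fibres \<pi> X n" and L: "transitive_group (\<pi> ` X) L"
    and nbs: "normal_block_system (\<pi> ` X) L \<C>"
    and C: "C \<in> \<C>" and W: "wstab_cond (\<pi> ` X) L \<C> C W" "W \<noteq> {id}"
  defines "\<B> \<equiv> (\<lambda>C. {x \<in> X. \<pi> x \<in> C}) ` \<C>"
  obtains V where "normal_block_system X (pullback \<pi> X L) \<B>" "V \<noteq> {id}"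
    "wstab_cond X (pullback \<pi> X L) \<B> {x \<in> X. \<pi> x \<in> C} V"
proof -
  let ?H = "pullback \<pi> X L"
  let ?P = "\<lambda>C. {x \<in> X. \<pi> x \<in> C}"
  note LS = transitive_groupD(3)[OF L]
  have H: "transitive_group X ?H" by (rule transitive_group_pullback[OF fib L])
  note HS = transitive_groupD(3)[OF H]
  note nb = normal_block_systemD[OF L nbs]
  note WD = wstab_condD[OF LS W(1)]
  note WS = subgroup_sym_onD[OF WD(1)]
  have CX: "C \<subseteq> \<pi> ` X" "C \<noteq> {}" if "C \<in> \<C>" for C using partition_on_subset[OF nb(2) that] by auto
  have part: "partition_on X \<B>"
  proof (rule partition_onI)
    show "\<Union>\<B> = X" using partition_onD1[OF nb(2)] by (auto simp: \<B>_def)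
    show "{} \<notin> \<B>" using CX by (fastforce simp: \<B>_def)
    show "disjnt A B" if "A \<in> \<B>" "B \<in> \<B>" "A \<noteq> B" for A B
      using that partition_on_eqI[OF nb(2)] by (fastforce simp: \<B>_def disjnt_def)
  qed
  have img: "h ` ?P C = ?P (k ` C)"
    if h: "h permutes X" "\<forall>x\<in>X. \<pi> (h x) = k (\<pi> x)" and k: "k permutes \<pi> ` X" for h k C
  proof
    show "h ` ?P C \<subseteq> ?P (k ` C)" using h permutes_in_image[OF h(1)] by auto
    show "?P (k ` C) \<subseteq> h ` ?P C"
    proof
      fix y assume y: "y \<in> ?P (k ` C)"
      define x where "x = inv' h y"
      have x: "h x = y" "x \<in> X"
        using y permutes_inverses(1)[OF h(1)] permutes_in_image[OF permutes_inv[OF h(1)]]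
        by (auto simp: x_def)
      then have "k (\<pi> x) \<in> k ` C" using h(2) y by auto
      then have "\<pi> x \<in> C" using permutes_inj[OF k] by (simp add: inj_image_mem_iff)
      then show "y \<in> h ` ?P C" using x by blast
    qed
  qed
  have inv: "h ` B \<in> \<B>" if hB: "h \<in> ?H" "B \<in> \<B>" for h B
  proof -
    obtain k where k: "h permutes X" "k \<in> L" "\<forall>x\<in>X. \<pi> (h x) = k (\<pi> x)"
      using hB(1) by (auto simp: pullback_def)
    obtain C where C: "C \<in> \<C>" "B = ?P C" using hB(2) by (auto simp: \<B>_def)
    show ?thesis
      unfolding C(2) img[OF k(1,3) subgroup_sym_onD(1)[OF LS k(2)]] \<B>_def
      using nb(3)[OF k(2) C(1)] by blast
  qed
  have fixI: "p \<in> fix_group ?H \<B>"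
    if p: "p permutes X" "\<forall>x\<in>X. \<pi> (p x) = k (\<pi> x)" and k: "k \<in> fix_group L \<C>" for p k
  proof -
    have kL: "k \<in> L" and kC: "\<And>C. C \<in> \<C> \<Longrightarrow> k ` C = C" using k by (auto simp: fix_group_def)
    have "p ` ?P C = ?P C" if "C \<in> \<C>" for C
      using img[OF p subgroup_sym_onD(1)[OF LS kL], of C] kC[OF that] by simp
    then show ?thesis using p kL by (auto simp: fix_group_def \<B>_def pullback_def)
  qed
  have nbsH: "normal_block_system X ?H \<B>"
    unfolding normal_block_system_iff[OF H]
  proof (intro conjI ballI part inv)
    fix B x y assume B: "B \<in> \<B>" "x \<in> B" "y \<in> B"
    then obtain C where C: "C \<in> \<C>" "x \<in> X" "y \<in> X" "\<pi> x \<in> C" "\<pi> y \<in> C" by (auto simp: \<B>_def)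
    obtain k where k: "k \<in> fix_group L \<C>" "k (\<pi> x) = \<pi> y" using nb(4)[OF C(1,4,5)] by blast
    have kp: "k permutes \<pi> ` X" using k(1) subgroup_sym_onD(1)[OF LS] by (simp add: fix_group_def)
    obtain p where "p permutes X" "\<And>x. x \<in> X \<Longrightarrow> \<pi> (p x) = k (\<pi> x)" "p x = y"
      using permutes_lift[OF fib kp _ C(2) _ C(3) k(2)[symmetric], of "{}"] by blast
    then show "\<exists>g\<in>fix_group ?H \<B>. g x = y" using fixI[OF _ _ k(1)] by blast
  qed
  \<comment> \<open>The full pullback of \<open>W\<close> may also permute points inside the fibres
    over \<open>C\<close>. Demanding the identity over the common fixed points \<open>T\<close> of
    \<open>W\<close> makes \<open>V\<close> trivial exactly over the blocks where \<open>W\<close>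
    is trivial.\<close>
  define T where "T = {z. \<forall>w\<in>W. w z = z}"
  define V where "V = {p \<in> pullback \<pi> X W. \<forall>x\<in>{x \<in> X. \<pi> x \<in> T}. p x = x}"
  have move: "\<exists>v\<in>V. v a = b" if w: "w \<in> W" and ab: "a \<in> X" "b \<in> X" "\<pi> b = w (\<pi> a)" "\<pi> a \<notin> T" for w a b
  proof -
    obtain p where p: "p permutes X" "\<And>x. x \<in> X \<Longrightarrow> \<pi> (p x) = w (\<pi> x)"
      "\<And>x. x \<in> X \<Longrightarrow> \<pi> x \<in> T \<Longrightarrow> p x = x" "p a = b"
      using permutes_lift[OF fib WS(1)[OF w] _ ab(1,4,2,3)] w by (auto simp: T_def)
    then have "p \<in> V" using w by (auto simp: V_def pullback_def)
    then show ?thesis using p(4) by blast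
  qed
  have "wstab_cond X ?H \<B> (?P C) V"
    unfolding wstab_cond_iff[OF HS]
  proof (intro conjI)
    show "subgroup V (sym_on X)"
      unfolding V_def by (rule subgroup_pointwise_stabiliser[OF subgroup_pullback[OF WD(1)]])
    show "V \<subseteq> fix_group ?H \<B>"
    proof
      fix v assume "v \<in> V"
      then obtain w where w: "v permutes X" "w \<in> W" "\<forall>x\<in>X. \<pi> (v x) = w (\<pi> x)"
        by (auto simp: V_def pullback_def)
      then show "v \<in> fix_group ?H \<B>" using fixI[OF w(1,3)] WD(2) by blast
    qed
    show "\<forall>v\<in>V. \<forall>x\<in>?P C. v x = x" using WD(3) by (auto simp: V_def T_def)
    show "\<forall>B\<in>\<B>. (\<forall>x\<in>B. \<forall>y\<in>B. \<exists>v\<in>V. v x = y) \<or> (\<forall>v\<in>V. \<forall>x\<in>B. v x = x)"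
    proof
      fix B assume "B \<in> \<B>"
      then obtain D where D: "D \<in> \<C>" "B = ?P D" by (auto simp: \<B>_def)
      show "(\<forall>x\<in>B. \<forall>y\<in>B. \<exists>v\<in>V. v x = y) \<or> (\<forall>v\<in>V. \<forall>x\<in>B. v x = x)"
      proof (cases "D \<subseteq> T")
        case True
        then show ?thesis by (auto simp: V_def D(2))
      next
        case False
        then obtain d w where d: "d \<in> D" "w \<in> W" "w d \<noteq> d" by (auto simp: T_def)
        have trD: "\<exists>w\<in>W. w x = y" if "x \<in> D" "y \<in> D" for x y
          using WD(4)[OF D(1)] d that by blast
        have wD: "w ` D = D" using d(2) D(1) WD(2) by (auto simp: fix_group_def)
        \<comment> \<open>A point of \<open>D\<close> fixed by all of \<open>W\<close> would, by
          transitivity, equal the moved point \<open>d\<close>.\<close>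
        have nT: "z \<notin> T" if zD: "z \<in> D" for z
        proof
          assume z: "z \<in> T"
          obtain u where "u \<in> W" "u z = d" using trD[OF zD d(1)] by blast
          then have "z = d" using z by (auto simp: T_def)
          then show False using z d by (auto simp: T_def)
        qed
        have "\<exists>v\<in>V. v x = y" if xy: "x \<in> B" "y \<in> B" for x y
        proof -
          have "x \<in> X" "y \<in> X" "\<pi> x \<in> D" "\<pi> y \<in> D" using xy D(2) by auto
          moreover from this obtain u where "u \<in> W" "u (\<pi> x) = \<pi> y" using trD by blast
          ultimately show ?thesis using move[of u x y] nT by simp
        qed
        then show ?thesis by blast
      qed
    qed
  qed
  moreover have "V \<noteq> {id}"
  proof
    assume V: "V = {id}"
    obtain w where w: "w \<in> W" "w \<noteq> id" using W(2) WS(2) by blast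
    then obtain z where z: "w z \<noteq> z" by (auto simp: fun_eq_iff)
    then have zX: "z \<in> \<pi> ` X" using permutes_not_in[OF WS(1)[OF w(1)]] by blast
    then have "w z \<in> \<pi> ` X" using permutes_in_image[OF WS(1)[OF w(1)]] by simp
    \<comment> \<open>Points over \<open>z\<close> and over \<open>w z\<close> lie in different
      fibres, so an element of \<open>V\<close> taking \<open>a\<close> to \<open>b\<close> is not
      the identity.\<close>
    then obtain a b where ab: "a \<in> X" "b \<in> X" "z = \<pi> a" "w z = \<pi> b" using zX by blast
    moreover have "\<pi> a \<notin> T" using w(1) z ab(3) by (auto simp: T_def)
    ultimately obtain v where "v \<in> V" "v a = b" using move[OF w(1) ab(1,2)] by auto
    then show False using V z ab by auto
  qed
  ultimately show ?thesis using that nbsH by blast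
qed

section \<open>The classes of points swapped by transpositions\<close>

text \<open>Transitivity of the relation comes from conjugating one transposition by another:
  \<open>(x y)(y z)(x y) = (x z)\<close>.\<close>

lemma transposition_equiv:
  assumes G: "subgroup G (sym_on X)"
  shows "equiv X {(x, y). x \<in> X \<and> y \<in> X \<and> transpose x y \<in> G}"
proof (rule equivI)
  let ?R = "{(x, y). x \<in> X \<and> y \<in> X \<and> transpose x y \<in> G}"
  show "?R \<subseteq> X \<times> X" by auto
  show "refl_on X ?R" using subgroup_sym_onD(2)[OF G] by (auto simp: refl_on_def)
  show "sym ?R" by (auto simp: sym_def transpose_commute)
  show "trans ?R"
  proof (rule transI, clarify)
    fix x y z assume xyz: "x \<in> X" "z \<in> X" "transpose x y \<in> G" "transpose y z \<in> G"
    show "transpose x z \<in> G"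
    proof (cases "x = z \<or> y = z")
      case True
      then show ?thesis using xyz subgroup_sym_onD(2)[OF G] by auto
    next
      case False
      then have "transpose x y \<circ> transpose y z \<circ> transpose x y = transpose x z"
        by (intro transpose_comp_triple) auto
      then show ?thesis using subgroup_sym_onD(3)[OF G] xyz by metis
    qed
  qed
qed

text \<open>The map \<open>\<pi>\<close> numbers the classes of points swapped by transpositions of
  \<open>G\<close>. Each element of the pullback differs from an element of \<open>G\<close> by a
  permutation inside the classes, which also belongs to \<open>G\<close>. Transitivity makes the
  classes equally large, and the transposition of \<open>a\<close> and \<open>a'\<close> gives
  \<open>n\<close> at least two.\<close>

lemma three_half_closed_imp_pullback:
  assumes G: "three_half_closed X G" and nG: "\<not> nine_eighth_closed X G"
  obtains \<pi> :: "'a \<Rightarrow> nat" and k n K where "2 \<le> n" "\<pi> ` X = {..<k}" "equal_fibres \<pi> X n"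
    "nine_eighth_closed {..<k} K" "G = pullback \<pi> X K"
proof -
  have trG: "transitive_group X G" using G by (simp add: three_half_closed_def five_half_closed_def)
  note GS = transitive_groupD(3)[OF trG]
  note GD = subgroup_sym_onD[OF GS]
  note fin = transitive_groupD(1)[OF trG]
  obtain H \<B> B W where H: "transitive_group X H" "H \<subseteq> G" "normal_block_system X H \<B>"
    and W: "B \<in> \<B>" "wstab_cond X H \<B> B W" "W \<noteq> {id}"
    using nG trG unfolding nine_eighth_closed_iff by auto
  obtain A a a' where A: "A \<in> \<B>" "a \<in> A" "a' \<in> A" "a \<noteq> a'" using wstab_cond_moves[OF H(1,3) W(2,3)] .
  have aX: "a \<in> X" "a' \<in> X" using partition_on_subset(1)[OF normal_block_systemD(2)[OF H(1,3)] A(1)] A by auto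
  have taa: "transpose a a' \<in> G"
    by (rule permutes_block_in_three_half_closed[OF G H W A(1) permutes_swap_id[OF A(2,3)]])
  define R where "R = {(x, y). x \<in> X \<and> y \<in> X \<and> transpose x y \<in> G}"
  have R: "equiv X R" unfolding R_def by (rule transposition_equiv[OF GS])
  \<comment> \<open>Classes are numbered by natural numbers so that the induced group acts on
    \<open>{..<k}\<close>, as members of \<open>class_K\<close> do.\<close>
  have "finite (X // R)" using fin R by (simp add: finite_quotient equiv_type)
  then obtain f where f: "bij_betw f (X // R) {..<card (X // R)}"
    using ex_bij_betw_finite_nat by (metis atLeast0LessThan)
  define k where "k = card (X // R)"
  define \<pi> where "\<pi> x = f (R `` {x})" for x
  have \<pi>: "\<pi> x = \<pi> y \<longleftrightarrow> transpose x y \<in> G" if "x \<in> X" "y \<in> X" for x y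
  proof -
    have "\<pi> x = \<pi> y \<longleftrightarrow> R `` {x} = R `` {y}"
      unfolding \<pi>_def using bij_betw_imp_inj_on[OF f] that by (simp add: inj_on_eq_iff quotientI)
    also have "\<dots> \<longleftrightarrow> (x, y) \<in> R" using R that by (rule eq_equiv_class_iff)
    finally show ?thesis using that by (simp add: R_def)
  qed
  have \<pi>X: "\<pi> ` X = {..<k}"
  proof -
    have "\<pi> ` X = f ` (X // R)" by (auto simp: \<pi>_def quotient_def)
    then show ?thesis using bij_betw_imp_surj_on[OF f] by (simp add: k_def)
  qed
  have inv: "\<pi> (g x) = \<pi> (g y) \<longleftrightarrow> \<pi> x = \<pi> y" if g: "g \<in> G" and xy: "x \<in> X" "y \<in> X" for g x y
  proof -
    \<comment> \<open>Conjugating the transposition of \<open>x\<close> and \<open>y\<close> by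
      \<open>h\<close> gives the transposition of \<open>h x\<close> and \<open>h y\<close>; so
      \<open>G\<close> permutes the classes.\<close>
    have imp: "transpose (h x) (h y) \<in> G" if h: "h \<in> G" "transpose x y \<in> G" for h x y
    proof -
      have "transpose (h x) (h y) = h \<circ> transpose x y \<circ> inv' h"
        using permutes_inverses[OF GD(1)[OF h(1)]] permutes_inv_eq[OF GD(1)[OF h(1)]]
        by (auto simp: fun_eq_iff transpose_def)
      then show ?thesis using GD(3)[OF GD(3)[OF h] GD(4)[OF h(1)]] by simp
    qed
    have "g x \<in> X" "g y \<in> X" using permutes_in_image[OF GD(1)[OF g]] xy by auto
    then show ?thesis
      using \<pi> xy imp[OF g, of x y] imp[OF GD(4)[OF g], of "g x" "g y"] permutes_inverses(2)[OF GD(1)[OF g]]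
      by auto
  qed
  define K where "K = pushforward \<pi> X G"
  have GP: "G \<subseteq> pullback \<pi> X {k. k permutes \<pi> ` X}" and GK: "G \<subseteq> pullback \<pi> X K"
  proof -
    have "\<exists>k. k permutes \<pi> ` X \<and> (\<forall>x\<in>X. \<pi> (g x) = k (\<pi> x))" if g: "g \<in> G" for g
    proof -
      obtain k where "k permutes \<pi> ` X" "\<And>x. x \<in> X \<Longrightarrow> \<pi> (g x) = k (\<pi> x)"
        using permutes_descend[OF fin GD(1)[OF g], of \<pi>] inv[OF g] by blast
      then show ?thesis by blast
    qed
    then show "G \<subseteq> pullback \<pi> X {k. k permutes \<pi> ` X}" "G \<subseteq> pullback \<pi> X K"
      using GD(1) by (fastforce simp: pullback_def K_def pushforward_def)+
  qed
  have KG: "pullback \<pi> X K \<subseteq> G"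
  proof
    fix p assume "p \<in> pullback \<pi> X K"
    then obtain k g where p: "p permutes X" and k: "k permutes \<pi> ` X" and g: "g \<in> G"
      and e: "\<And>x. x \<in> X \<Longrightarrow> \<pi> (p x) = k (\<pi> x)" "\<And>x. x \<in> X \<Longrightarrow> \<pi> (g x) = k (\<pi> x)"
      by (auto simp: pullback_def K_def pushforward_def)
    note gp = GD(1)[OF g]
    \<comment> \<open>\<open>p\<close> and \<open>g\<close> induce the same \<open>k\<close>, so
      \<open>inv' g \<circ> p\<close> preserves every class and is a product of transpositions in
      \<open>G\<close>.\<close>
    have pres: "\<pi> ((inv' g \<circ> p) x) = \<pi> x" if x: "x \<in> X" for x
    proof -
      define y where "y = inv' g (p x)"
      have y: "y \<in> X" "g y = p x"
        using x permutes_in_image[OF p] permutes_in_image[OF permutes_inv[OF gp]] permutes_inverses(1)[OF gp]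
        by (auto simp: y_def)
      then have "k (\<pi> y) = k (\<pi> x)" using e[of x] e[of y] x by metis
      then show ?thesis using permutes_inj[OF k] by (simp add: inj_eq y_def)
    qed
    have "inv' g \<circ> p \<in> G"
    proof (rule fibrewise_permutation_in_group[OF GS fin])
      show "transpose x y \<in> G" if "x \<in> X" "y \<in> X" "\<pi> x = \<pi> y" for x y using \<pi> that by simp
    qed (rule permutes_compose[OF p permutes_inv[OF gp]], rule pres)
    then have "g \<circ> (inv' g \<circ> p) \<in> G" by (rule GD(3)[OF g])
    moreover have "g \<circ> (inv' g \<circ> p) = p" using permutes_inverses(1)[OF gp] by auto
    ultimately show "p \<in> G" by simp
  qed
  define n where "n = card {x \<in> X. \<pi> x = \<pi> a}"
  have fib: "equal_fibres \<pi> X n"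
    unfolding equal_fibres_def
  proof (intro conjI ballI fin)
    fix z assume "z \<in> \<pi> ` X"
    then obtain x where x: "x \<in> X" "z = \<pi> x" by blast
    obtain g where g: "g \<in> G" "g a = x" using transitive_groupD(4)[OF trG aX(1) x(1)] by blast
    note gp = GD(1)[OF g(1)]
    \<comment> \<open>An element of \<open>G\<close> taking \<open>a\<close> to \<open>x\<close>
      maps the class of \<open>a\<close> onto that of \<open>x\<close>.\<close>
    have "g ` {y \<in> X. \<pi> y = \<pi> a} = {y \<in> X. \<pi> y = \<pi> x}"
    proof
      show "g ` {y \<in> X. \<pi> y = \<pi> a} \<subseteq> {y \<in> X. \<pi> y = \<pi> x}"
        using inv[OF g(1) _ aX(1)] g(2) permutes_in_image[OF gp] by auto
      show "{y \<in> X. \<pi> y = \<pi> x} \<subseteq> g ` {y \<in> X. \<pi> y = \<pi> a}"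
      proof
        fix y assume y: "y \<in> {y \<in> X. \<pi> y = \<pi> x}"
        define u where "u = inv' g y"
        have u: "u \<in> X" "g u = y"
          using y permutes_in_image[OF permutes_inv[OF gp]] permutes_inverses(1)[OF gp] by (auto simp: u_def)
        then have "\<pi> u = \<pi> a" using inv[OF g(1) u(1) aX(1)] g(2) y by simp
        then show "y \<in> g ` {y \<in> X. \<pi> y = \<pi> a}" using u by blast
      qed
    qed
    then show "card {y \<in> X. \<pi> y = z} = n"
      unfolding n_def x(2) using card_image[OF permutes_inj_on[OF gp]] by metis
  qed
  have "{a, a'} \<subseteq> {x \<in> X. \<pi> x = \<pi> a}" using aX taa \<pi>[OF aX] by auto
  then have "card {a, a'} \<le> n" unfolding n_def using fin by (intro card_mono) auto
  then have n: "2 \<le> n" using A(4) by simp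
  have trK: "transitive_group (\<pi> ` X) K" unfolding K_def by (rule transitive_group_pushforward[OF trG GP])
  have "V = {id}"
    if L: "transitive_group (\<pi> ` X) L" "L \<subseteq> K" "normal_block_system (\<pi> ` X) L \<C>"
      and V: "C \<in> \<C>" "wstab_cond (\<pi> ` X) L \<C> C V" for L \<C> C V
  proof (rule ccontr)
    let ?P = "\<lambda>C. {x \<in> X. \<pi> x \<in> C}"
    assume V': "V \<noteq> {id}"
    obtain U where U: "normal_block_system X (pullback \<pi> X L) (?P ` \<C>)" "U \<noteq> {id}"
      "wstab_cond X (pullback \<pi> X L) (?P ` \<C>) (?P C) U"
      using wstab_cond_pullback[OF fib L(1,3) V V'] .
    obtain D z z' where D: "D \<in> \<C>" "z \<in> D" "z' \<in> D" "z \<noteq> z'" using wstab_cond_moves[OF L(1,3) V(2) V'] .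
    have "D \<subseteq> \<pi> ` X" using partition_on_subset(1)[OF normal_block_systemD(2)[OF L(1,3)] D(1)] .
    then obtain x y where xy: "x \<in> X" "y \<in> X" "z = \<pi> x" "z' = \<pi> y" using D by blast
    \<comment> \<open>\<open>x\<close> and \<open>y\<close> share a lifted block, so the full
      symmetric group of that block puts their transposition into \<open>G\<close>, although
      \<open>\<pi>\<close> separates them.\<close>
    have "transpose x y \<in> G"
    proof (rule permutes_block_in_three_half_closed[OF G transitive_group_pullback[OF fib L(1)] _ U(1) _ U(3,2)])
      show "pullback \<pi> X L \<subseteq> G" using pullback_mono[OF L(2)] KG by blast
      show "transpose x y permutes ?P D" using xy D by (intro permutes_swap_id) auto
    qed (use V D in auto)
    then show False using \<pi> xy D(4) by simp
  qed
  then have "nine_eighth_closed (\<pi> ` X) K" unfolding nine_eighth_closed_iff using trK by blast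
  then show ?thesis using that[OF n \<pi>X fib] GK KG \<pi>X by simp
qed

section \<open>Wreath products as pullbacks\<close>

text \<open>When \<open>f\<close> acts on first coordinates by \<open>k\<close>, injectivity of
  \<open>f\<close> makes its action on second coordinates injective for each fixed \<open>x\<close>,
  hence a permutation of the finite set \<open>Y\<close>.\<close>

lemma wreath_sym_eq_pullback:
  assumes "finite Y" "Y \<noteq> {}"
  shows "wreath X K Y (carrier (sym_on Y)) = pullback fst (X \<times> Y) K"
proof
  show "wreath X K Y (carrier (sym_on Y)) \<subseteq> pullback fst (X \<times> Y) K"
    unfolding wreath_def pullback_def by fastforce
  show "pullback fst (X \<times> Y) K \<subseteq> wreath X K Y (carrier (sym_on Y))"
  proof
    fix f assume "f \<in> pullback fst (X \<times> Y) K"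
    then obtain k where f: "f permutes X \<times> Y" and k: "k \<in> K" "\<And>x y. x \<in> X \<Longrightarrow> y \<in> Y \<Longrightarrow> fst (f (x, y)) = k x"
      by (auto simp: pullback_def)
    \<comment> \<open>The default value \<open>y\<close> outside \<open>Y\<close> is what
      \<open>permutes\<close> demands.\<close>
    define h where "h x y = (if y \<in> Y then snd (f (x, y)) else y)" for x y
    have h: "h x permutes Y" if x: "x \<in> X" for x
    proof (rule inj_imp_permutes)
      show "h x y \<in> Y" if "y \<in> Y" for y
        using permutes_in_image[OF f, of "(x, y)"] x that by (auto simp: h_def mem_Times_iff)
      show "inj_on (h x) Y"
      proof (rule inj_onI)
        fix y y' assume y: "y \<in> Y" "y' \<in> Y" "h x y = h x y'"
        then have "f (x, y) = f (x, y')" using k(2) x by (simp add: h_def prod_eq_iff)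
        then show "y = y'" using permutes_inj[OF f] by (simp add: inj_eq)
      qed
    qed (use assms in \<open>simp_all add: h_def\<close>)
    moreover have "f (x, y) = (k x, h x y)" if "x \<in> X" "y \<in> Y" for x y
      using k(2) that by (simp add: h_def prod_eq_iff)
    ultimately show "f \<in> wreath X K Y (carrier (sym_on Y))"
      unfolding wreath_def using f k(1) by auto
  qed
qed

section \<open>Permutation isomorphism and coordinates on equal fibres\<close>

lemma map_permutation_pullback:
  assumes \<phi>: "bij_betw \<phi> X Y" and p: "p \<in> pullback (\<pi> \<circ> \<phi>) X K"
  shows "map_permutation X \<phi> p \<in> pullback \<pi> Y K"
proof -
  obtain k where k: "p permutes X" "k \<in> K" "\<And>x. x \<in> X \<Longrightarrow> \<pi> (\<phi> (p x)) = k (\<pi> (\<phi> x))"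
    using p by (auto simp: pullback_def)
  have "\<pi> (map_permutation X \<phi> p y) = k (\<pi> y)" if y: "y \<in> Y" for y
  proof -
    obtain x where "x \<in> X" "y = \<phi> x" using bij_betw_imp_surj_on[OF \<phi>] y by blast
    then show ?thesis using k(3) map_permutation_apply[OF bij_betw_imp_inj_on[OF \<phi>]] by metis
  qed
  then show ?thesis using map_permutation_permutes[OF \<phi> k(1)] k(2) by (auto simp: pullback_def)
qed

text \<open>The isomorphism is conjugation by \<open>\<phi>\<close>, with conjugation by the inverse
  bijection as its inverse.\<close>

lemma perm_isomorphic_pullbackI:
  assumes \<phi>: "bij_betw \<phi> X Y"
  shows "perm_isomorphic X (pullback (\<pi> \<circ> \<phi>) X K) Y (pullback \<pi> Y K)"
  unfolding perm_isomorphic_def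
proof (intro exI conjI ballI)
  let ?\<psi> = "map_permutation X \<phi>" and ?\<theta> = "inv_into X \<phi>"
  let ?G = "pullback (\<pi> \<circ> \<phi>) X K" and ?H = "pullback \<pi> Y K"
  note inj = bij_betw_imp_inj_on[OF \<phi>]
  have \<theta>: "bij_betw ?\<theta> Y X" by (rule bij_betw_inv_into[OF \<phi>])
  have \<theta>\<phi>: "?\<theta> (\<phi> x) = x" if "x \<in> X" for x using inv_into_f_f[OF inj that] .
  have \<phi>\<theta>: "\<phi> (?\<theta> y) = y" if "y \<in> Y" for y using bij_betw_inv_into_right[OF \<phi> that] .
  have GX: "p permutes X" if "p \<in> ?G" for p using that by (simp add: pullback_def)
  have HY: "q permutes Y" if "q \<in> ?H" for q using that by (simp add: pullback_def)
  have \<theta>H: "map_permutation Y ?\<theta> q \<in> ?G" if q: "q \<in> ?H" for q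
  proof (rule map_permutation_pullback[OF \<theta>])
    \<comment> \<open>Going forth and back along \<open>\<phi>\<close> recovers \<open>\<pi>\<close>
      on \<open>Y\<close>, and the pullback depends only on these values.\<close>
    have "((\<pi> \<circ> \<phi>) \<circ> ?\<theta>) y = \<pi> y" if "y \<in> Y" for y using \<phi>\<theta>[OF that] by simp
    then show "q \<in> pullback ((\<pi> \<circ> \<phi>) \<circ> ?\<theta>) Y K"
      using q permutes_in_image[OF HY[OF q]] by (auto simp: pullback_def)
  qed
  show "bij_betw \<phi> X Y" by (rule \<phi>)
  show "\<phi> (g x) = ?\<psi> g (\<phi> x)" if "g \<in> ?G" "x \<in> X" for g x
    using map_permutation_apply[OF inj that(2)] by simp
  have "bij_betw ?\<psi> ?G ?H"
  proof (rule bij_betw_byWitness[where f' = "map_permutation Y ?\<theta>"])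
    show "\<forall>p\<in>?G. map_permutation Y ?\<theta> (?\<psi> p) = p"
      using map_permutation_compose_inv[OF \<phi> GX \<theta>\<phi>] by blast
    show "\<forall>q\<in>?H. ?\<psi> (map_permutation Y ?\<theta> q) = q"
      using map_permutation_compose_inv[OF \<theta> HY \<phi>\<theta>] by blast
    show "?\<psi> ` ?G \<subseteq> ?H" using map_permutation_pullback[OF \<phi>] by blast
    show "map_permutation Y ?\<theta> ` ?H \<subseteq> ?G" using \<theta>H by blast
  qed
  then show "?\<psi> \<in> iso (group_on X ?G) (group_on Y ?H)"
    unfolding iso_def hom_def using map_permutation_pullback[OF \<phi>] map_permutation_compose'[OF inj GX]
    by auto
qed

text \<open>The intertwining equation forces \<open>\<psi> g\<close> to agree on \<open>Y\<close>
  with the conjugate of \<open>g\<close> by \<open>\<phi>\<close>, so membership in \<open>G\<close>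
  can be read off along \<open>\<pi> \<circ> \<phi>\<close>. Surjectivity of \<open>\<psi>\<close>
  shows that every element of that pullback occurs in \<open>G\<close>.\<close>

lemma perm_isomorphic_pullbackE:
  assumes G: "subgroup G (sym_on X)" and iso: "perm_isomorphic X G Y (pullback \<pi> Y K)"
  obtains \<phi> where "bij_betw \<phi> X Y" "G = pullback (\<pi> \<circ> \<phi>) X K"
proof -
  obtain \<phi> \<psi> where \<phi>: "bij_betw \<phi> X Y" and \<psi>: "\<psi> \<in> iso (group_on X G) (group_on Y (pullback \<pi> Y K))"
    and eq: "\<And>g x. g \<in> G \<Longrightarrow> x \<in> X \<Longrightarrow> \<phi> (g x) = \<psi> g (\<phi> x)"
    using iso unfolding perm_isomorphic_def by blast
  have bij: "bij_betw \<psi> G (pullback \<pi> Y K)" using \<psi> by (simp add: iso_def)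
  note inj = bij_betw_imp_inj_on[OF \<phi>]
  have "G = pullback (\<pi> \<circ> \<phi>) X K"
  proof
    show "G \<subseteq> pullback (\<pi> \<circ> \<phi>) X K"
    proof
      fix g assume g: "g \<in> G"
      obtain k where k: "k \<in> K" "\<And>y. y \<in> Y \<Longrightarrow> \<pi> (\<psi> g y) = k (\<pi> y)"
        using bij_betwE[OF bij] g by (auto simp: pullback_def)
      have "\<pi> (\<phi> (g x)) = k (\<pi> (\<phi> x))" if "x \<in> X" for x
        using eq[OF g that] k(2) bij_betwE[OF \<phi>] that by simp
      then show "g \<in> pullback (\<pi> \<circ> \<phi>) X K"
        using k(1) subgroup_sym_onD(1)[OF G g] by (auto simp: pullback_def)
    qed
    show "pullback (\<pi> \<circ> \<phi>) X K \<subseteq> G"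
    proof
      fix p assume p: "p \<in> pullback (\<pi> \<circ> \<phi>) X K"
      then have pp: "p permutes X" by (simp add: pullback_def)
      obtain g where g: "g \<in> G" "\<psi> g = map_permutation X \<phi> p"
        using map_permutation_pullback[OF \<phi> p] bij_betw_imp_surj_on[OF bij] by (metis imageE)
      note gp = subgroup_sym_onD(1)[OF G g(1)]
      have "g = p"
      proof (rule permutes_eqI[OF gp pp])
        fix x assume x: "x \<in> X"
        have "\<phi> (g x) = \<phi> (p x)" using eq[OF g(1) x] g(2) map_permutation_apply[OF inj x] by simp
        then show "g x = p x"
          using inj permutes_in_image[OF gp] permutes_in_image[OF pp] x by (simp add: inj_on_eq_iff)
      qed
      then show "p \<in> G" using g(1) by simp
    qed
  qed
  then show ?thesis using that \<phi> by blast
qed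

lemma equal_fibres_fst:
  assumes \<phi>: "bij_betw \<phi> X (A \<times> {..<n::nat})" and "finite X"
  shows "equal_fibres (fst \<circ> \<phi>) X n"
  unfolding equal_fibres_def
proof (intro conjI ballI assms(2))
  fix z assume "z \<in> (fst \<circ> \<phi>) ` X"
  then have z: "z \<in> A" using bij_betwE[OF \<phi>] by force
  have "\<phi> ` {x \<in> X. (fst \<circ> \<phi>) x = z} = {z} \<times> {..<n}"
  proof
    show "\<phi> ` {x \<in> X. (fst \<circ> \<phi>) x = z} \<subseteq> {z} \<times> {..<n}" using bij_betwE[OF \<phi>] by (fastforce simp: mem_Times_iff)
    show "{z} \<times> {..<n} \<subseteq> \<phi> ` {x \<in> X. (fst \<circ> \<phi>) x = z}"
    proof
      fix u assume u: "u \<in> {z} \<times> {..<n}"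
      then have "u \<in> \<phi> ` X" using z bij_betw_imp_surj_on[OF \<phi>] by auto
      then obtain x where "x \<in> X" "u = \<phi> x" by blast
      then show "u \<in> \<phi> ` {x \<in> X. (fst \<circ> \<phi>) x = z}" using u by auto
    qed
  qed
  moreover have "inj_on \<phi> {x \<in> X. (fst \<circ> \<phi>) x = z}"
    using bij_betw_imp_inj_on[OF \<phi>] by (rule inj_on_subset) auto
  ultimately show "card {x \<in> X. (fst \<circ> \<phi>) x = z} = n"
    using card_image[of \<phi> "{x \<in> X. (fst \<circ> \<phi>) x = z}"] by (simp add: card_cartesian_product)
qed

text \<open>Numbering the points of each fibre by \<open>{..<n}\<close> supplies the second
  coordinate.\<close>

lemma equal_fibres_bij:
  assumes "equal_fibres \<pi> X n"
  obtains \<phi> where "bij_betw \<phi> X (\<pi> ` X \<times> {..<n})" "\<And>x. x \<in> X \<Longrightarrow> fst (\<phi> x) = \<pi> x"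
proof -
  let ?F = "\<lambda>z. {x \<in> X. \<pi> x = z}"
  have "\<exists>f. bij_betw f (?F z) {..<n}" if "z \<in> \<pi> ` X" for z
    using assms that unfolding equal_fibres_def by (intro finite_same_card_bij) auto
  then obtain f where f: "\<And>z. z \<in> \<pi> ` X \<Longrightarrow> bij_betw (f z) (?F z) {..<n}" by metis
  define \<phi> where "\<phi> x = (\<pi> x, f (\<pi> x) x)" for x
  have "inj_on \<phi> X"
  proof (rule inj_onI)
    fix x y assume xy: "x \<in> X" "y \<in> X" "\<phi> x = \<phi> y"
    then have "\<pi> x = \<pi> y" "f (\<pi> x) x = f (\<pi> x) y" by (auto simp: \<phi>_def)
    then show "x = y" using bij_betw_imp_inj_on[OF f, of "\<pi> x"] xy by (auto simp: inj_on_def)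
  qed
  moreover have "\<phi> ` X = \<pi> ` X \<times> {..<n}"
  proof
    show "\<phi> ` X \<subseteq> \<pi> ` X \<times> {..<n}" using bij_betwE[OF f] by (auto simp: \<phi>_def)
    show "\<pi> ` X \<times> {..<n} \<subseteq> \<phi> ` X"
    proof clarify
      fix a i assume a: "a \<in> X" and i: "i < n"
      have "i \<in> f (\<pi> a) ` ?F (\<pi> a)" using bij_betw_imp_surj_on[OF f, of "\<pi> a"] a i by auto
      then obtain x where "x \<in> X" "\<pi> x = \<pi> a" "i = f (\<pi> a) x" by auto
      then show "(\<pi> a, i) \<in> \<phi> ` X" by (intro image_eqI[of _ _ x]) (simp_all add: \<phi>_def)
    qed
  qed
  ultimately have "bij_betw \<phi> X (\<pi> ` X \<times> {..<n})" by (simp add: bij_betw_def)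
  then show ?thesis using that by (simp add: \<phi>_def)
qed

text \<open>Replaces the permutation isomorphism with a wreath product by a map with equal fibres:
  the first coordinate of the relabelling in one direction, a numbering of the fibres in the
  other.\<close>

lemma class_L_iff:
  "(d, G) \<in> class_L \<longleftrightarrow> (\<exists>k K n \<pi>. nine_eighth_closed {..<k} K \<and> 2 \<le> n \<and> \<pi> ` {..<d} = {..<k::nat} \<and>
     equal_fibres \<pi> {..<d} n \<and> G = pullback \<pi> {..<d} K)"
  (is "?L \<longleftrightarrow> ?R")
proof
  assume ?L
  then obtain k n :: nat and K where G: "subgroup G (sym_on {..<d})" and K: "nine_eighth_closed {..<k} K"
    and n: "2 \<le> n" and iso: "perm_isomorphic {..<d} G ({..<k} \<times> {..<n})
      (wreath {..<k} K {..<n} (carrier (sym_on {..<n})))"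
    unfolding class_L_def class_K_def mem_Collect_eq case_prod_conv by blast
  have "wreath {..<k} K {..<n} (carrier (sym_on {..<n})) = pullback fst ({..<k} \<times> {..<n}) K"
    using n by (intro wreath_sym_eq_pullback) (auto simp: lessThan_empty_iff)
  then obtain \<phi> where \<phi>: "bij_betw \<phi> {..<d} ({..<k} \<times> {..<n})" "G = pullback (fst \<circ> \<phi>) {..<d} K"
    using perm_isomorphic_pullbackE[OF G] iso by metis
  moreover have "(fst \<circ> \<phi>) ` {..<d} = {..<k}"
    unfolding image_comp[symmetric] bij_betw_imp_surj_on[OF \<phi>(1)] using n
    by (auto simp: fst_image_times lessThan_empty_iff)
  moreover have "equal_fibres (fst \<circ> \<phi>) {..<d} n" by (rule equal_fibres_fst[OF \<phi>(1)]) simp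
  ultimately show ?R using K n by blast
next
  assume ?R
  then obtain k n :: nat and K and \<pi> :: "nat \<Rightarrow> nat" where K: "nine_eighth_closed {..<k} K" and n: "2 \<le> n"
    and \<pi>: "\<pi> ` {..<d} = {..<k}" "equal_fibres \<pi> {..<d} n" and G: "G = pullback \<pi> {..<d} K" by blast
  have "subgroup K (sym_on (\<pi> ` {..<d}))"
    using K transitive_groupD(3) unfolding \<pi>(1) nine_eighth_closed_iff by blast
  then have "subgroup G (sym_on {..<d})" unfolding G by (rule subgroup_pullback)
  obtain \<phi> where \<phi>: "bij_betw \<phi> {..<d} ({..<k} \<times> {..<n})" "\<And>x. x \<in> {..<d} \<Longrightarrow> fst (\<phi> x) = \<pi> x"
    using equal_fibres_bij[OF \<pi>(2)] unfolding \<pi>(1) by metis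
  have "G = pullback (fst \<circ> \<phi>) {..<d} K"
    unfolding G pullback_def using \<phi>(2) permutes_in_image[of _ "{..<d}"]
    by (intro Collect_cong conj_cong refl bex_cong ball_cong) simp_all
  moreover have "wreath {..<k} K {..<n} (carrier (sym_on {..<n})) = pullback fst ({..<k} \<times> {..<n}) K"
    using n by (intro wreath_sym_eq_pullback) (auto simp: lessThan_empty_iff)
  ultimately have "perm_isomorphic {..<d} G ({..<k} \<times> {..<n})
      (wreath {..<k} K {..<n} (carrier (sym_on {..<n})))"
    using perm_isomorphic_pullbackI[OF \<phi>(1)] by metis
  then show ?L using \<open>subgroup G (sym_on {..<d})\<close> K n
    unfolding class_L_def class_K_def mem_Collect_eq case_prod_conv by blast
qed

section \<open>Symmetric groups of prime degree\<close>

lemma transitive_group_sym: "finite X \<Longrightarrow> X \<noteq> {} \<Longrightarrow> transitive_group X {p. p permutes X}"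
  using group.subgroup_self[OF group_sym_on, of X]
  by (auto simp: transitive_group_def transitive_on_def
      intro: exI[of _ "transpose x y" for x y] permutes_swap_id)

text \<open>A nontrivial stabiliser requires a block with two points. All blocks have the same size,
  which divides the degree, so the only block is \<open>X\<close>; but the stabiliser fixes its
  block pointwise. Degree one is included to supply the trivial group for
  \<open>class_L\<close>.\<close>

lemma nine_eighth_closed_prime_degree:
  assumes G: "transitive_group X G" and X: "prime (card X) \<or> card X = 1"
  shows "nine_eighth_closed X G"
  unfolding nine_eighth_closed_iff
proof (intro conjI[OF G] allI impI, elim conjE, rule ccontr)
  fix H \<B> B W
  assume H: "transitive_group X H" "normal_block_system X H \<B>" and B: "B \<in> \<B>"
    and W: "wstab_cond X H \<B> B W" "W \<noteq> {id}"
  note nb = normal_block_systemD[OF H]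
  note HS = transitive_groupD(3)[OF H(1)]
  note fin = transitive_groupD(1)[OF G]
  obtain A x y where A: "A \<in> \<B>" "x \<in> A" "y \<in> A" "x \<noteq> y" using wstab_cond_moves[OF H W] .
  have sub: "C \<subseteq> X" "C \<noteq> {}" if "C \<in> \<B>" for C using partition_on_subset[OF nb(2) that] by auto
  have "finite A" using fin sub(1)[OF A(1)] by (rule rev_finite_subset)
  then have "card {x, y} \<le> card A" using A by (intro card_mono) auto
  then have A2: "2 \<le> card A" using A(4) by simp
  have same: "card C = card A" if C: "C \<in> \<B>" for C
  proof -
    obtain c where c: "c \<in> C" using sub[OF C] by blast
    then obtain h where h: "h \<in> H" "h x = c" using transitive_groupD(4)[OF H(1)] sub A C by blast
    have "h ` A = C" using partition_on_eqI[OF nb(2) nb(3)[OF h(1) A(1)] C _ c] h(2) A(2) by blast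
    then show ?thesis using card_image[OF permutes_inj_on[OF subgroup_sym_onD(1)[OF HS h(1)]]] by metis
  qed
  have "card X = card A * card \<B>"
    using card_partition[of \<B> "card A"] same fin sub finite_elements[OF fin nb(2)]
      partition_onD1[OF nb(2)] partition_on_eqI[OF nb(2)] by (metis disjoint_iff)
  then have "card A dvd card X" by simp
  then have "card A = card X" using X A2 by (auto simp: prime_nat_iff)
  then have "B = X" using same[OF B] sub(1)[OF B] fin by (metis card_subset_eq)
  then have "w = id" if "w \<in> W" for w
    using wstab_condD(3)[OF HS W(1) that] subgroup_sym_onD(1)[OF wstab_condD(1)[OF HS W(1)] that]
    by (intro permutes_eqI[of w X id]) simp_all
  then show False using W(2) subgroup_sym_onD(2)[OF wstab_condD(1)[OF HS W(1)]] by blast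
qed

lemma equal_fibres_mod:
  assumes "0 < a"
  shows "equal_fibres (\<lambda>x. x mod a) {..<a * b} b"
  unfolding equal_fibres_def
proof (intro conjI ballI)
  fix z assume "z \<in> (\<lambda>x. x mod a) ` {..<a * b}"
  then have z: "z < a" using assms by auto
  have "{x \<in> {..<a * b}. x mod a = z} = (\<lambda>q. a * q + z) ` {..<b}"
  proof
    show "{x \<in> {..<a * b}. x mod a = z} \<subseteq> (\<lambda>q. a * q + z) ` {..<b}"
    proof
      fix x assume x: "x \<in> {x \<in> {..<a * b}. x mod a = z}"
      then have "x = a * (x div a) + z" "x div a < b" by (auto simp: less_mult_imp_div_less mult.commute)
      then show "x \<in> (\<lambda>q. a * q + z) ` {..<b}" by blast
    qed
    show "(\<lambda>q. a * q + z) ` {..<b} \<subseteq> {x \<in> {..<a * b}. x mod a = z}"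
    proof clarsimp
      fix q assume "q < b"
      then have "a * q + z < a * Suc q" "a * Suc q \<le> a * b" using z by (simp, intro mult_le_mono) auto
      then show "a * q + z < a * b \<and> z mod a = z" using z by simp
    qed
  qed
  moreover have "inj_on (\<lambda>q. a * q + z) {..<b}" using assms by (auto simp: inj_on_def)
  ultimately show "card {x \<in> {..<a * b}. x mod a = z} = b" by (simp add: card_image)
qed simp

text \<open>For \<open>d = a * b\<close> with both factors above 1, reduction modulo
  \<open>a\<close> has \<open>a\<close> fibres of size \<open>b\<close>, so the symmetric group
  contains the pullback of the symmetric group of degree \<open>a\<close> and is not
  9/8-closed.\<close>

lemma nine_eighth_closed_sym_iff:
  fixes d :: nat
  assumes "2 \<le> d"
  shows "nine_eighth_closed {..<d} {p. p permutes {..<d}} \<longleftrightarrow> prime d"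
proof
  assume nine: "nine_eighth_closed {..<d} {p. p permutes {..<d}}"
  show "prime d"
  proof (rule ccontr)
    assume "\<not> prime d"
    then obtain a where a: "a dvd d" "a \<noteq> 1" "a \<noteq> d" using assms by (auto simp: prime_nat_iff)
    then obtain b where d: "d = a * b" by blast
    then have "a \<noteq> 0" "b \<noteq> 1" using a(3) assms by auto
    moreover have "b \<noteq> 0" using d assms by (cases "b = 0") auto
    ultimately have ab: "d = a * b" "1 < a" "1 < b" using d a(2) by auto
    have img: "(\<lambda>x. x mod a) ` {..<d} = {..<a}"
    proof
      show "(\<lambda>x. x mod a) ` {..<d} \<subseteq> {..<a}" using ab by auto
      show "{..<a} \<subseteq> (\<lambda>x. x mod a) ` {..<d}"
      proof
        fix z assume "z \<in> {..<a}"
        moreover have "a \<le> d" using ab by simp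
        ultimately show "z \<in> (\<lambda>x. x mod a) ` {..<d}" by (intro image_eqI[of _ _ z]) auto
      qed
    qed
    have "transitive_group ((\<lambda>x. x mod a) ` {..<d}) {p. p permutes {..<a}}"
      unfolding img using ab by (intro transitive_group_sym) (auto simp: lessThan_empty_iff)
    moreover have "equal_fibres (\<lambda>x. x mod a) {..<d} b"
      unfolding ab(1) using ab(2) by (intro equal_fibres_mod) simp
    moreover have "2 \<le> b" "2 \<le> card ((\<lambda>x. x mod a) ` {..<d})" unfolding img using ab by simp_all
    moreover have "pullback (\<lambda>x. x mod a) {..<d} {p. p permutes {..<a}} \<subseteq> {p. p permutes {..<d}}"
      by (auto simp: pullback_def)
    ultimately have "\<not> nine_eighth_closed {..<d} {p. p permutes {..<d}}"
      by (rule pullback_not_nine_eighth_closed)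
    then show False using nine by simp
  qed
next
  assume "prime d"
  then show "nine_eighth_closed {..<d} {p. p permutes {..<d}}"
    using assms by (intro nine_eighth_closed_prime_degree transitive_group_sym) (auto simp: lessThan_empty_iff)
qed

section \<open>The union of the two classes and their overlap\<close>

text \<open>\<open>G\<close> is its own pullback along the identity, whose fibres have size
  1.\<close>

lemma nine_eighth_closed_imp_three_half_closed:
  assumes G: "nine_eighth_closed X G"
  shows "three_half_closed X G"
proof -
  have tr: "transitive_group X G" using G by (simp add: nine_eighth_closed_iff)
  note GX = subgroup_sym_onD(1)[OF transitive_groupD(3)[OF tr]]
  have "pullback id X G = G"
  proof
    show "pullback id X G \<subseteq> G"
    proof
      fix p assume "p \<in> pullback id X G"
      then obtain g where p: "p permutes X" "g \<in> G" "\<And>x. x \<in> X \<Longrightarrow> p x = g x" by (auto simp: pullback_def)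
      then show "p \<in> G" using permutes_eqI[OF p(1) GX[OF p(2)] p(3)] by simp
    qed
    show "G \<subseteq> pullback id X G" using GX by (auto simp: pullback_def)
  qed
  moreover have "{y \<in> X. y = x} = {x}" if "x \<in> X" for x using that by auto
  then have "equal_fibres id X 1" using transitive_groupD(1)[OF tr] by (simp add: equal_fibres_def)
  ultimately show ?thesis using three_half_closed_pullback[of id X G 1] G by simp
qed

lemma pullback_point:
  assumes "\<pi> ` X = {z}" "subgroup K (sym_on (\<pi> ` X))"
  shows "pullback \<pi> X K = {p. p permutes X}"
proof
  show "{p. p permutes X} \<subseteq> pullback \<pi> X K"
  proof clarify
    fix p assume p: "p permutes X"
    have z: "\<pi> x = z" if "x \<in> X" for x using assms(1) that by blast
    have "\<pi> (p x) = id (\<pi> x)" if "x \<in> X" for x using z permutes_in_image[OF p, of x] that by simp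
    then show "p \<in> pullback \<pi> X K" using p subgroup_sym_onD(2)[OF assms(2)] unfolding pullback_def by blast
  qed
qed (auto simp: pullback_def)

text \<open>The overlap is found as follows: a pullback with at least two fibres of size at least
  two is not 9/8-closed, so a common member has \<open>k = 1\<close> and is a full symmetric group,
  which is 9/8-closed exactly in prime degree.\<close>

theorem theorem6p10:
  shows "class_three_half = class_K \<union> class_L \<and> class_K \<inter> class_L = prime_symmetric_groups"
proof
  have "(d, G) \<in> class_three_half \<longleftrightarrow> (d, G) \<in> class_K \<union> class_L" for d G
  proof
    assume "(d, G) \<in> class_three_half"
    then have G: "three_half_closed {..<d} G" by (simp add: class_three_half_def)
    show "(d, G) \<in> class_K \<union> class_L"
    proof (cases "nine_eighth_closed {..<d} G")
      case False
      then show ?thesis using three_half_closed_imp_pullback[OF G False] class_L_iff by (metis UnI2)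
    qed (simp add: class_K_def)
  next
    assume "(d, G) \<in> class_K \<union> class_L"
    then have "three_half_closed {..<d} G"
      using nine_eighth_closed_imp_three_half_closed three_half_closed_pullback
      unfolding class_K_def class_L_iff Un_iff by (metis case_prod_conv mem_Collect_eq)
    then show "(d, G) \<in> class_three_half" by (simp add: class_three_half_def)
  qed
  then show "class_three_half = class_K \<union> class_L" by (simp add: set_eq_iff)
  have "(d, G) \<in> class_K \<inter> class_L \<longleftrightarrow> (d, G) \<in> prime_symmetric_groups" for d G
  proof
    assume "(d, G) \<in> class_K \<inter> class_L"
    then obtain k n :: nat and K and \<pi> :: "nat \<Rightarrow> nat" where G: "nine_eighth_closed {..<d} G"
      and K: "nine_eighth_closed {..<k} K" and n: "2 \<le> n"
      and \<pi>: "\<pi> ` {..<d} = {..<k}" "equal_fibres \<pi> {..<d} n" and eq: "G = pullback \<pi> {..<d} K"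
      by (auto simp: class_K_def class_L_iff)
    have trK: "transitive_group (\<pi> ` {..<d}) K" using K by (simp add: \<pi>(1) nine_eighth_closed_iff)
    have "\<not> 2 \<le> k" using pullback_not_nine_eighth_closed[OF trK \<pi>(2) n] G by (auto simp: \<pi>(1) eq)
    moreover have "k \<noteq> 0" using transitive_groupD(2)[OF trK] by (auto simp: \<pi>(1))
    ultimately have "k = 1" by simp
    then have \<pi>0: "\<pi> ` {..<d} = {0}" using \<pi>(1) by auto
    then have G_sym: "G = {p. p permutes {..<d}}"
      unfolding eq using transitive_groupD(3)[OF trK] by (intro pullback_point)
    \<comment> \<open>The single fibre is everything, so the degree is \<open>n\<close> and
      therefore at least 2.\<close>
    have "{x \<in> {..<d}. \<pi> x = 0} = {..<d}" using \<pi>0 by auto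
    then have "d = n" using \<pi>(2) \<pi>0 by (simp add: equal_fibres_def)
    then show "(d, G) \<in> prime_symmetric_groups"
      using G n nine_eighth_closed_sym_iff[of d] by (simp add: G_sym prime_symmetric_groups_def)
  next
    assume "(d, G) \<in> prime_symmetric_groups"
    then have d: "prime d" and G: "G = {p. p permutes {..<d}}" by (auto simp: prime_symmetric_groups_def)
    have d2: "2 \<le> d" using d by (rule prime_ge_2_nat)
    \<comment> \<open>The symmetric group is the pullback of the trivial group of degree one along
      the constant map.\<close>
    let ?\<pi> = "\<lambda>_::nat. 0::nat"
    have img: "?\<pi> ` {..<d} = {..<1}" using d2 by (auto simp: image_constant_conv lessThan_empty_iff)
    have one: "transitive_group {..<1::nat} {p. p permutes {..<1}}"
      by (intro transitive_group_sym) (auto simp: lessThan_empty_iff)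
    have "nine_eighth_closed {..<1::nat} {p. p permutes {..<1}}"
      using one by (rule nine_eighth_closed_prime_degree) simp
    moreover have "equal_fibres ?\<pi> {..<d} d" by (simp add: equal_fibres_def)
    moreover have "G = pullback ?\<pi> {..<d} {p. p permutes {..<1}}"
      unfolding G using transitive_groupD(3)[OF one] img
      by (intro pullback_point[symmetric, where z = 0]) auto
    ultimately have "(d, G) \<in> class_L" unfolding class_L_iff using d2 img by blast
    moreover have "(d, G) \<in> class_K" using d nine_eighth_closed_sym_iff[OF d2] by (simp add: class_K_def G)
    ultimately show "(d, G) \<in> class_K \<inter> class_L" by simp
  qed
  then show "class_K \<inter> class_L = prime_symmetric_groups" by (simp add: set_eq_iff)
qed

end
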